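(* Consider the revenue management model with a single pool of $C$ reusable resource units and advanced reservation, with traffic intensity $\rho=\sum_{k=1}^M\lambda_k\mu_k$, operated under the improved class selection policy (ICSP) with parameter $\epsilon$. In the regime $C=(1+\epsilon)\rho\to\infty$, for any fixed small $\epsilon>0$ (with the rewards $r_k$, the distributions of $(D_k,S_k)$ and the proportions $\lambda_k/\sum_j\lambda_j$ kept fixed), the ICSP asymptotically obtains at least a fraction $1-\epsilon$ of the optimal expected long-run average revenue, i.e. $$\liminf \frac{\mathcal{R}(ICSP)}{\mathcal{R}(OPT)}\ \ge\ 1-\epsilon .$$
   Context: Model: there is a pool of $C$ identical resource units, $C<\infty$ an integer. Customers of classes $k=1,\dots,M$ arrive according to independent Poisson processes with rates $\lambda_k>0$. A class-$k$ customer arriving at time $t$ requests one unit for the service interval $[t+d,t+d+s]$, where $(d,s)$ is drawn from the joint law of $(D_k,S_k)$, independently of arrivals and of other customers; $D_k$ takes integer values in $\{0,\dots,u_k\}$, $S_k$ takes integer values in $\{1,\dots,v_k\}$, and $\mu_k=\mathbb{E}[S_k]$. A request can be accepted only if the maximum number of units already reserved over the requested interval is strictly smaller than $C$; a request may also be rejected although capacity is available. Decisions are made immediately upon arrival; rejected customers are lost; accepted reservations cannot be cancelled. An accepted class-$k$ customer pays $r_k>0$ per unit of service time. Classes are numbered so that $r_1\ge r_2\ge\dots\ge r_M$. For an admission policy $\pi$ (decisions depending on the current state, i.e. the entire booking profile of class, reservation and service information of customers booked or in service), $\mathcal{R}(\pi)=\liminf_{T\to\infty}\mathbb{E}[\mathcal{R}_\pi(T)]/T$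 where $\mathcal{R}_\pi(T)$ is the revenue achieved by $\pi$ over $[0,T]$; $\mathcal{R}(OPT)$ is the supremum of $\mathcal{R}(\pi)$ over all feasible admission policies. ICSP with parameter $\epsilon$, where $0<\epsilon<\min_k \lambda_k\mu_k/C$: let $\lambda_{dsk}=\lambda_k\mathbb{P}(D_k=d,S_k=s)$ and consider the knapsack linear program $$\max_{\alpha}\ \sum_{k=1}^M\sum_{d,s} r_k\alpha_{dsk}\lambda_{dsk}s\quad\text{s.t.}\quad \sum_{k=1}^M\sum_{d,s}\alpha_{dsk}\lambda_{dsk}s\le(1-\epsilon)C,\quad 0\le\alpha_{dsk}\le1 .$$ Its greedy optimal solution depends only on $k$: there is a class $M'\le M$ with $\alpha^*_k=1$ for $k<M'$, $\alpha^*_{M'}\in[0,1]$, and $\alpha^*_k=0$ for $k>M'$. The ICSP accepts an arriving customer of class $k<M'$ whenever there is sufficient unreserved capacity throughout the requested interval; accepts a customer of class $M'$ with probability $\alpha^*_{M'}$ (independently of everything else) if there is sufficient unreserved capacity throughout the requested interval; and rejects all customers of classes $k>M'$. *)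

theory Defs
  imports "HOL-Probability.Probability"
begin

section \<open>Poisson processes\<close>

text \<open>A point process is given by its successive epochs \<open>A 0 < A 1 < ...\<close>;
  \<open>arrivals_upto A t\<close> is the associated counting process.\<close>

definition arrivals_upto :: "(nat \<Rightarrow> 'w \<Rightarrow> real) \<Rightarrow> real \<Rightarrow> 'w \<Rightarrow> nat" where
  "arrivals_upto A t \<omega> = card {n. A n \<omega> \<le> t}"

text \<open>Since \<open>card\<close> of an infinite set is 0, local finiteness of the points is required explicitly.
  Independence of the increments is stated for infinite time grids, which covers finite ones.\<close>

definition poisson_process :: "'w measure \<Rightarrow> real \<Rightarrow> (nat \<Rightarrow> 'w \<Rightarrow> real) \<Rightarrow> bool" where
  "poisson_process P rate A \<longleftrightarrow>
     (\<forall>n. A n \<in> borel_measurable P) \<and>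
     (AE \<omega> in P. 0 < A 0 \<omega> \<and> strict_mono (\<lambda>n. A n \<omega>) \<and>
        filterlim (\<lambda>n. A n \<omega>) at_top sequentially) \<and>
     (\<forall>s t. 0 \<le> s \<and> s < t \<longrightarrow>
        distr P (count_space UNIV) (\<lambda>\<omega>. arrivals_upto A t \<omega> - arrivals_upto A s \<omega>)
          = measure_pmf (poisson_pmf (rate * (t - s)))) \<and>
     (\<forall>ts :: nat \<Rightarrow> real. 0 \<le> ts 0 \<and> strict_mono ts \<longrightarrow>
        prob_space.indep_vars P (\<lambda>_. count_space UNIV)
          (\<lambda>i \<omega>. arrivals_upto A (ts (Suc i)) \<omega> - arrivals_upto A (ts i) \<omega>) UNIV)"

section \<open>Stochastic primitives\<close>

text \<open>\<open>A k n\<close> is the arrival epoch of the \<open>n\<close>-th customer of class \<open>k\<close>, \<open>X k n = (d, s)\<close> is that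
  customer's request, and \<open>U k n\<close> is a uniform variable that serves to randomize the admission
  decision. The law of \<open>(D\<^sub>k, S\<^sub>k)\<close> is the pmf \<open>G k\<close>; classes are \<open>1, ..., M\<close>.\<close>

datatype source = Arrivals nat | Request nat nat | Coin nat nat

primrec source_events ::
  "'w measure \<Rightarrow> (nat \<Rightarrow> nat \<Rightarrow> 'w \<Rightarrow> real) \<Rightarrow> (nat \<Rightarrow> nat \<Rightarrow> 'w \<Rightarrow> nat \<times> nat) \<Rightarrow>
   (nat \<Rightarrow> nat \<Rightarrow> 'w \<Rightarrow> real) \<Rightarrow> source \<Rightarrow> 'w set set"
where
  "source_events P A X U (Arrivals k) =
     sets (vimage_algebra (space P) (\<lambda>\<omega> n. A k n \<omega>) (Pi\<^sub>M UNIV (\<lambda>_. borel)))"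
| "source_events P A X U (Request k n) =
     sets (vimage_algebra (space P) (X k n) (count_space UNIV))"
| "source_events P A X U (Coin k n) =
     sets (vimage_algebra (space P) (U k n) borel)"

locale reservation_system = prob_space P
  for P :: "'w measure" +
  fixes M :: nat
    and lam :: "nat \<Rightarrow> real"
    and G :: "nat \<Rightarrow> (nat \<times> nat) pmf"
    and A :: "nat \<Rightarrow> nat \<Rightarrow> 'w \<Rightarrow> real"
    and X :: "nat \<Rightarrow> nat \<Rightarrow> 'w \<Rightarrow> nat \<times> nat"
    and U :: "nat \<Rightarrow> nat \<Rightarrow> 'w \<Rightarrow> real"
  assumes arrivals: "k \<in> {1..M} \<Longrightarrow> poisson_process P (lam k) (A k)"
    and request_measurable: "k \<in> {1..M} \<Longrightarrow> X k n \<in> measurable P (count_space UNIV)"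
    and request_law: "k \<in> {1..M} \<Longrightarrow> distr P (count_space UNIV) (X k n) = measure_pmf (G k)"
    and coin_measurable: "k \<in> {1..M} \<Longrightarrow> U k n \<in> borel_measurable P"
    and coin_law: "k \<in> {1..M} \<Longrightarrow> distr P lborel (U k n) = uniform_measure lborel {0..1}"
    and independence: "indep_sets (source_events P A X U)
          (Arrivals ` {1..M} \<union> case_prod Request ` ({1..M} \<times> UNIV)
             \<union> case_prod Coin ` ({1..M} \<times> UNIV))"

definition mean_service :: "(nat \<times> nat) pmf \<Rightarrow> real" where
  "mean_service g = measure_pmf.expectation g (\<lambda>(d, s). real s)"

definition traffic_intensity :: "nat \<Rightarrow> (nat \<Rightarrow> real) \<Rightarrow> (nat \<Rightarrow> (nat \<times> nat) pmf) \<Rightarrow> real" where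
  "traffic_intensity M lam G = (\<Sum>k=1..M. lam k * mean_service (G k))"

section \<open>States and admission policies\<close>

text \<open>A booking \<open>(k, e, d, s)\<close> is an accepted customer of class \<open>k\<close> who arrived \<open>e\<close> time units ago
  with request \<open>(d, s)\<close>; the requested interval, measured from the present, is
  \<open>[d - e, d - e + s]\<close>. A policy gives the probability with which a request \<open>(d, s)\<close> of
  class \<open>k\<close> is accepted in a state. Deterministic policies are those with values 0 and 1.\<close>

type_synonym booking = "nat \<times> real \<times> nat \<times> nat"
type_synonym state = "booking multiset"
type_synonym policy = "state \<Rightarrow> nat \<Rightarrow> nat \<times> nat \<Rightarrow> real"

definition reserved :: "state \<Rightarrow> real \<Rightarrow> nat" where
  "reserved x y = size (filter_mset (\<lambda>(k, e, d, s). y \<in> {real d - e .. real d - e + real s}) x)"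

definition max_reserved :: "state \<Rightarrow> nat \<times> nat \<Rightarrow> nat" where
  "max_reserved x = (\<lambda>(d, s). Max (reserved x ` {real d .. real d + real s}))"

lemma max_reserved_less_iff:
  "max_reserved x (d, s) < C \<longleftrightarrow> (\<forall>y \<in> {real d .. real d + real s}. reserved x y < C)"
proof -
  have "reserved x ` {real d .. real d + real s} \<subseteq> {..size x}"
    by (auto simp: reserved_def intro: size_filter_mset_lesseq)
  then have "finite (reserved x ` {real d .. real d + real s})"
    by (rule finite_subset) simp
  then show ?thesis
    unfolding max_reserved_def by (subst prod.case, subst Max_less_iff) auto
qed

definition feasible_policy :: "nat \<Rightarrow> policy \<Rightarrow> bool" where
  "feasible_policy C \<pi> \<longleftrightarrow>
     (\<forall>x k q. 0 \<le> \<pi> x k q \<and> \<pi> x k q \<le> 1 \<and> (C \<le> max_reserved x q \<longrightarrow> \<pi> x k q = 0))"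

section \<open>Evolution of the system along a sample path\<close>

text \<open>A customer is a pair \<open>(k, n)\<close>: the \<open>n\<close>-th customer of class \<open>k\<close>. A sample path consists of
  the arrival epochs \<open>a\<close>, the requests \<open>q\<close> and the coins \<open>u\<close> of all customers. The system is empty
  at time 0. Almost surely the arrival epochs are distinct and locally finite, so that \<open>rank\<close>
  enumerates the customers of all classes in their order of arrival; \<open>accepted_below j\<close> is the set of
  those among the first \<open>j\<close> customers who are accepted.\<close>

type_synonym customer = "nat \<times> nat"

definition customers :: "nat \<Rightarrow> customer set" where
  "customers M = {1..M} \<times> UNIV"

definition rank :: "nat \<Rightarrow> (customer \<Rightarrow> real) \<Rightarrow> customer \<Rightarrow> nat" where
  "rank M a c = card {c' \<in> customers M. a c' < a c}"

text \<open>The state at time \<open>t\<close>, where \<open>B\<close> is the set of customers accepted before \<open>t\<close>, comprises those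
  who are still booked or in service.\<close>

definition state_at ::
  "(customer \<Rightarrow> real) \<Rightarrow> (customer \<Rightarrow> nat \<times> nat) \<Rightarrow> customer set \<Rightarrow> real \<Rightarrow> state"
where
  "state_at a q B t = image_mset (\<lambda>c. (fst c, t - a c, q c))
     (mset_set {c \<in> B. t \<le> a c + real (fst (q c)) + real (snd (q c))})"

primrec accepted_below ::
  "nat \<Rightarrow> policy \<Rightarrow> (customer \<Rightarrow> real) \<Rightarrow> (customer \<Rightarrow> nat \<times> nat) \<Rightarrow> (customer \<Rightarrow> real) \<Rightarrow>
   nat \<Rightarrow> customer set"
where
  "accepted_below M \<pi> a q u 0 = {}"
| "accepted_below M \<pi> a q u (Suc j) = accepted_below M \<pi> a q u j \<union>
     {c \<in> customers M. rank M a c = j \<and>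
        u c < \<pi> (state_at a q (accepted_below M \<pi> a q u j) (a c)) (fst c) (q c)}"

definition accepted ::
  "nat \<Rightarrow> policy \<Rightarrow> (customer \<Rightarrow> real) \<Rightarrow> (customer \<Rightarrow> nat \<times> nat) \<Rightarrow> (customer \<Rightarrow> real) \<Rightarrow>
   customer set"
where
  "accepted M \<pi> a q u = (\<Union>j. accepted_below M \<pi> a q u j)"

section \<open>Revenue\<close>

text \<open>Revenue accrues at rate \<open>r k\<close> while an accepted customer of class \<open>k\<close> is in service.\<close>

definition service_time_within :: "real \<Rightarrow> real \<Rightarrow> nat \<times> nat \<Rightarrow> real" where
  "service_time_within T t = (\<lambda>(d, s). measure lborel ({t + real d .. t + real d + real s} \<inter> {0..T}))"

definition path_revenue ::
  "nat \<Rightarrow> (nat \<Rightarrow> real) \<Rightarrow> policy \<Rightarrow> (customer \<Rightarrow> real) \<Rightarrow> (customer \<Rightarrow> nat \<times> nat) \<Rightarrow>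
   (customer \<Rightarrow> real) \<Rightarrow> real \<Rightarrow> real"
where
  "path_revenue M r \<pi> a q u T =
     (\<Sum>c \<in> {c \<in> accepted M \<pi> a q u. a c \<le> T}. r (fst c) * service_time_within T (a c) (q c))"

definition revenue ::
  "nat \<Rightarrow> (nat \<Rightarrow> real) \<Rightarrow> (nat \<Rightarrow> nat \<Rightarrow> 'w \<Rightarrow> real) \<Rightarrow> (nat \<Rightarrow> nat \<Rightarrow> 'w \<Rightarrow> nat \<times> nat) \<Rightarrow>
   (nat \<Rightarrow> nat \<Rightarrow> 'w \<Rightarrow> real) \<Rightarrow> policy \<Rightarrow> real \<Rightarrow> 'w \<Rightarrow> real"
where
  "revenue M r A X U \<pi> T \<omega> =
     path_revenue M r \<pi> (\<lambda>(k, n). A k n \<omega>) (\<lambda>(k, n). X k n \<omega>) (\<lambda>(k, n). U k n \<omega>) T"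

definition long_run_revenue ::
  "'w measure \<Rightarrow> nat \<Rightarrow> (nat \<Rightarrow> real) \<Rightarrow> (nat \<Rightarrow> nat \<Rightarrow> 'w \<Rightarrow> real) \<Rightarrow>
   (nat \<Rightarrow> nat \<Rightarrow> 'w \<Rightarrow> nat \<times> nat) \<Rightarrow> (nat \<Rightarrow> nat \<Rightarrow> 'w \<Rightarrow> real) \<Rightarrow> policy \<Rightarrow> ennreal"
where
  "long_run_revenue P M r A X U \<pi> =
     Liminf at_top (\<lambda>T::real. (\<integral>\<^sup>+\<omega>. ennreal (revenue M r A X U \<pi> T \<omega>) \<partial>P) / ennreal T)"

text \<open>The supremum ranges over the feasible policies whose revenue is a random variable, i.e. for
  which the expectation makes sense.\<close>

definition optimal_revenue ::
  "'w measure \<Rightarrow> nat \<Rightarrow> nat \<Rightarrow> (nat \<Rightarrow> real) \<Rightarrow> (nat \<Rightarrow> nat \<Rightarrow> 'w \<Rightarrow> real) \<Rightarrow>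
   (nat \<Rightarrow> nat \<Rightarrow> 'w \<Rightarrow> nat \<times> nat) \<Rightarrow> (nat \<Rightarrow> nat \<Rightarrow> 'w \<Rightarrow> real) \<Rightarrow> ennreal"
where
  "optimal_revenue P C M r A X U =
     (SUP \<pi> \<in> {\<pi>. feasible_policy C \<pi> \<and> (\<forall>T. revenue M r A X U \<pi> T \<in> borel_measurable P)}.
        long_run_revenue P M r A X U \<pi>)"

section \<open>The knapsack linear program and the improved class selection policy\<close>

definition lp_load ::
  "nat \<Rightarrow> (nat \<Rightarrow> nat) \<Rightarrow> (nat \<Rightarrow> nat) \<Rightarrow> (nat \<Rightarrow> real) \<Rightarrow> (nat \<Rightarrow> (nat \<times> nat) pmf) \<Rightarrow>
   (nat \<Rightarrow> nat \<Rightarrow> nat \<Rightarrow> real) \<Rightarrow> real"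
where
  "lp_load M u v lam G \<alpha> =
     (\<Sum>k=1..M. \<Sum>d=0..u k. \<Sum>s=1..v k. \<alpha> d s k * (lam k * pmf (G k) (d, s)) * real s)"

definition lp_value ::
  "nat \<Rightarrow> (nat \<Rightarrow> nat) \<Rightarrow> (nat \<Rightarrow> nat) \<Rightarrow> (nat \<Rightarrow> real) \<Rightarrow> (nat \<Rightarrow> real) \<Rightarrow>
   (nat \<Rightarrow> (nat \<times> nat) pmf) \<Rightarrow> (nat \<Rightarrow> nat \<Rightarrow> nat \<Rightarrow> real) \<Rightarrow> real"
where
  "lp_value M u v r lam G \<alpha> =
     (\<Sum>k=1..M. \<Sum>d=0..u k. \<Sum>s=1..v k. r k * \<alpha> d s k * (lam k * pmf (G k) (d, s)) * real s)"

definition lp_feasible ::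
  "nat \<Rightarrow> (nat \<Rightarrow> nat) \<Rightarrow> (nat \<Rightarrow> nat) \<Rightarrow> (nat \<Rightarrow> real) \<Rightarrow> (nat \<Rightarrow> (nat \<times> nat) pmf) \<Rightarrow>
   real \<Rightarrow> (nat \<Rightarrow> nat \<Rightarrow> nat \<Rightarrow> real) \<Rightarrow> bool"
where
  "lp_feasible M u v lam G b \<alpha> \<longleftrightarrow>
     lp_load M u v lam G \<alpha> \<le> b \<and>
     (\<forall>k \<in> {1..M}. \<forall>d \<in> {0..u k}. \<forall>s \<in> {1..v k}. 0 \<le> \<alpha> d s k \<and> \<alpha> d s k \<le> 1)"

definition lp_optimal ::
  "nat \<Rightarrow> (nat \<Rightarrow> nat) \<Rightarrow> (nat \<Rightarrow> nat) \<Rightarrow> (nat \<Rightarrow> real) \<Rightarrow> (nat \<Rightarrow> real) \<Rightarrow>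
   (nat \<Rightarrow> (nat \<times> nat) pmf) \<Rightarrow> real \<Rightarrow> (nat \<Rightarrow> nat \<Rightarrow> nat \<Rightarrow> real) \<Rightarrow> bool"
where
  "lp_optimal M u v r lam G b \<alpha> \<longleftrightarrow>
     lp_feasible M u v lam G b \<alpha> \<and>
     (\<forall>\<beta>. lp_feasible M u v lam G b \<beta> \<longrightarrow> lp_value M u v r lam G \<beta> \<le> lp_value M u v r lam G \<alpha>)"

definition class_fraction :: "nat \<Rightarrow> real \<Rightarrow> nat \<Rightarrow> real" where
  "class_fraction M' \<alpha> k = (if k < M' then 1 else if k = M' then \<alpha> else 0)"

definition greedy_solution ::
  "nat \<Rightarrow> (nat \<Rightarrow> nat) \<Rightarrow> (nat \<Rightarrow> nat) \<Rightarrow> (nat \<Rightarrow> real) \<Rightarrow> (nat \<Rightarrow> real) \<Rightarrow>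
   (nat \<Rightarrow> (nat \<times> nat) pmf) \<Rightarrow> real \<Rightarrow> nat \<Rightarrow> real \<Rightarrow> bool"
where
  "greedy_solution M u v r lam G b M' \<alpha> \<longleftrightarrow>
     M' \<in> {1..M} \<and> 0 \<le> \<alpha> \<and> \<alpha> \<le> 1 \<and>
     lp_optimal M u v r lam G b (\<lambda>d s k. class_fraction M' \<alpha> k)"

definition icsp :: "nat \<Rightarrow> nat \<Rightarrow> real \<Rightarrow> policy" where
  "icsp C M' \<alpha> x k q = (if max_reserved x q < C then class_fraction M' \<alpha> k else 0)"

lemma icsp_feasible: "0 \<le> \<alpha> \<Longrightarrow> \<alpha> \<le> 1 \<Longrightarrow> feasible_policy C (icsp C M' \<alpha>)"
  by (auto simp: feasible_policy_def icsp_def class_fraction_def)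

end

theory Submission
  imports Defs
begin

text \<open>
  Since the capacity is \<open>C = (1 + \<epsilon>) \<rho>\<close>, both revenues can be compared with the offered value
  \<open>V = \<Sum> r\<^sub>k \<lambda>\<^sub>k \<mu>\<^sub>k\<close>, the revenue rate of serving everybody. No policy earns more than \<open>V\<close>
  (\<open>optimal_revenue_le\<close>). The linear program has capacity \<open>(1 - \<epsilon>) C = (1 - \<epsilon>\<^sup>2) \<rho>\<close>, so that
  accepting every request with probability \<open>1 - \<epsilon>\<^sup>2\<close> is feasible and the greedy solution is worth at
  least \<open>(1 - \<epsilon>\<^sup>2) V\<close> (\<open>lp_value_greedy_ge\<close>). If the ICSP blocked nobody whom the linear program
  selects, it would earn this value. Hence it suffices to show that blocking costs at most the
  fraction \<open>(1 - \<epsilon>\<^sup>2) - (1 - \<epsilon>) = \<epsilon> (1 - \<epsilon>)\<close> of \<open>V\<close>.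

  Call a customer willing if the coin lets the customer through. The customers accepted by the ICSP
  are willing, so the units reserved at a time \<open>z\<close> are bounded by the willing customers whose
  requested interval contains \<open>z\<close>, as in a system without capacity limit. Cut time into cells of
  length \<open>h = \<epsilon>\<close>. If \<open>z\<close> lies in a given cell, then a willing customer of class \<open>k\<close> with request
  \<open>(d, s)\<close> can occupy a unit at \<open>z\<close> only if the arrival falls into a window of length \<open>s + h\<close> determined
  by the cell. These window counts are Poisson with total mean at most \<open>(1 + h) (1 - \<epsilon>) C =
  (1 - \<epsilon>\<^sup>2) C\<close>, because \<open>s \<ge> 1\<close>. If each of them exceeds its mean by less than a suitable \<open>\<theta> C\<close>, their
  sum stays below \<open>C\<close> and every willing customer who requests such times is accepted
  (\<open>accepted_in_typical_cell\<close>). If moreover the numbers of willing customers arriving in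
  the cell are close to their means, the cell yields almost its share of the linear program value.

  A cell for which all these counts deviate by less than \<open>\<theta> C\<close> is called typical. By Chebyshev's
  inequality and a union bound over a fixed number of windows, a cell is atypical with probability
  \<open>O(1 / C)\<close> (\<open>typical_event_prob\<close>). Summing over the cells in \<open>[0, T]\<close> gives the lower bound on the
  revenue of the ICSP (\<open>long_run_revenue_icsp_ge\<close>); working with cells instead of single customers
  avoids conditioning on an arrival. The only probabilistic input is the mean and
  the variance of the number of points of an independently thinned Poisson process in one interval
  (\<open>thinned_points_deviation\<close>).
\<close>

section \<open>Factorial moments of the Poisson distribution\<close>

lemma poisson_weight_sums:
  fixes m :: real
  shows "(\<lambda>n. m ^ n / fact n * exp (- m)) sums 1"
proof -
  have "(\<lambda>n. m ^ n /\<^sub>R fact n * exp (- m)) sums (exp m * exp (- m))"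
    by (intro sums_mult2 exp_converges)
  then show ?thesis
    by (simp add: divide_inverse mult.commute flip: exp_add)
qed

text \<open>Reduces moments of a counting variable, which occur as nonnegative integrals, to real series.\<close>

lemma nn_integral_poisson_pmf:
  fixes f :: "nat \<Rightarrow> nat"
  assumes "0 < m" and "(\<lambda>n. real (f n) * (m ^ n / fact n * exp (- m))) sums x"
  shows "(\<integral>\<^sup>+n. of_nat (f n) \<partial>measure_pmf (poisson_pmf m)) = ennreal x"
proof -
  have "(\<integral>\<^sup>+n. of_nat (f n) \<partial>measure_pmf (poisson_pmf m)) =
      (\<Sum>n. ennreal (real (f n) * (m ^ n / fact n * exp (- m))))"
    using assms(1)
    by (auto simp: nn_integral_measure_pmf nn_integral_count_space_nat ennreal_mult ennreal_of_nat_eq_real_of_nat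
        mult_ac intro!: suminf_cong simp flip: ennreal_mult)
  also have "\<dots> = ennreal x"
    using assms by (intro suminf_ennreal_eq) auto
  finally show ?thesis .
qed

lemma poisson_mean:
  assumes "0 < m"
  shows "(\<integral>\<^sup>+n. of_nat n \<partial>measure_pmf (poisson_pmf m)) = ennreal m"
proof (rule nn_integral_poisson_pmf[where f = "\<lambda>n. n", OF assms])
  let ?w = "\<lambda>n. m ^ n / fact n * exp (- m)" and ?g = "\<lambda>n. real n * (m ^ n / fact n * exp (- m))"
  have "?g (Suc n) = m * ?w n" for n
    by (simp add: field_simps del: of_nat_Suc)
  with sums_mult[OF poisson_weight_sums[of m], of m]
  have "(\<lambda>n. ?g (Suc n)) sums m"
    by (simp del: of_nat_Suc power_Suc fact_Suc)
  then show "?g sums m"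
    by (subst (asm) sums_Suc_iff) simp
qed

text \<open>The factorial moment is preferred to the second moment because independent thinning scales it by
  the square of the retention probability.\<close>

lemma poisson_factorial_moment:
  assumes "0 < m"
  shows "(\<integral>\<^sup>+n. of_nat (n * (n - 1)) \<partial>measure_pmf (poisson_pmf m)) = ennreal (m\<^sup>2)"
proof (rule nn_integral_poisson_pmf[where f = "\<lambda>n. n * (n - 1)", OF assms])
  let ?w = "\<lambda>n. m ^ n / fact n * exp (- m)" and ?g = "\<lambda>n. real (n * (n - 1)) * (m ^ n / fact n * exp (- m))"
  have "?g (Suc (Suc n)) = m\<^sup>2 * ?w n" for n
  proof -
    have "real (Suc (Suc n) * (Suc (Suc n) - 1)) = real (Suc (Suc n)) * real (Suc n)"
      by (simp only: of_nat_mult diff_Suc_1)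
    then show ?thesis
      by (simp add: field_simps power2_eq_square del: of_nat_Suc of_nat_mult)
  qed
  with sums_mult[OF poisson_weight_sums[of m], of "m\<^sup>2"]
  have "(\<lambda>n. ?g (Suc (Suc n))) sums m\<^sup>2"
    by (simp del: of_nat_Suc power_Suc fact_Suc)
  then have "(\<lambda>n. ?g (Suc n)) sums m\<^sup>2"
    by (subst (asm) sums_Suc_iff) simp
  then show "?g sums m\<^sup>2"
    by (subst (asm) sums_Suc_iff) simp
qed

section \<open>Thinned Poisson processes\<close>

lemma suminf_indicator_card:
  fixes S :: "nat set"
  assumes "finite S"
  shows "(\<Sum>n. indicator S n :: ennreal) = of_nat (card S)"
  using assms by (simp flip: nn_integral_count_space_nat)

text \<open>The number of ordered pairs of distinct elements; written as a series of indicators it can be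
  integrated term by term.\<close>

lemma suminf_pairs_card:
  fixes S :: "nat set"
  assumes "finite S"
  shows "(\<Sum>n. \<Sum>m. if m = n then 0 else indicator S n * indicator S m :: ennreal)
    = of_nat (card S * (card S - 1))"
proof -
  have "(\<Sum>m. if m = n then 0 else indicator S n * indicator S m :: ennreal)
      = of_nat (card S - 1) * indicator S n" for n
  proof -
    have "(\<Sum>m. if m = n then 0 else indicator S n * indicator S m :: ennreal)
        = (\<Sum>m. indicator S n * indicator (S - {n}) m)"
      by (intro suminf_cong) (auto simp: indicator_def)
    also have "\<dots> = indicator S n * of_nat (card (S - {n}))"
      using assms by (subst ennreal_suminf_cmult) (simp add: suminf_indicator_card)
    finally show ?thesis
      using assms by (cases "n \<in> S") auto
  qed
  then show ?thesis
    using assms by (simp add: suminf_indicator_card mult.commute)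
qed

definition points_in :: "(nat \<Rightarrow> 'w \<Rightarrow> real) \<Rightarrow> (nat \<Rightarrow> 'w set) \<Rightarrow> real \<Rightarrow> real \<Rightarrow> 'w \<Rightarrow> nat" where
  "points_in A E x y \<omega> = card {n. A n \<omega> \<in> {x<..y} \<and> \<omega> \<in> E n}"

context prob_space
begin

lemma poisson_process_finite:
  assumes "poisson_process M rate A"
  shows "AE \<omega> in M. \<forall>t. finite {n. A n \<omega> \<le> t}"
proof -
  have "AE \<omega> in M. filterlim (\<lambda>n. A n \<omega>) at_top sequentially"
    using assms by (auto simp: poisson_process_def)
  then show ?thesis
  proof eventually_elim
    case (elim \<omega>)
    show ?case
    proof
      fix t
      from elim have "eventually (\<lambda>n. t < A n \<omega>) sequentially"
        by (simp add: filterlim_at_top_dense)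
      then obtain n0 where n0: "\<And>n. n0 \<le> n \<Longrightarrow> t < A n \<omega>"
        by (auto simp: eventually_sequentially)
      then have "{n. A n \<omega> \<le> t} \<subseteq> {..<n0}"
        by (auto simp: not_le[symmetric])
      then show "finite {n. A n \<omega> \<le> t}"
        by (rule finite_subset) simp
    qed
  qed
qed

lemma points_in_UNIV_eq_arrivals:
  assumes "poisson_process M rate A" "x < y"
  shows "AE \<omega> in M. points_in A (\<lambda>n. UNIV) x y \<omega> = arrivals_upto A y \<omega> - arrivals_upto A x \<omega>"
  using poisson_process_finite[OF assms(1)]
proof eventually_elim
  case (elim \<omega>)
  have "{n. A n \<omega> \<in> {x<..y}} = {n. A n \<omega> \<le> y} - {n. A n \<omega> \<le> x}"
    by auto
  moreover have "{n. A n \<omega> \<le> x} \<subseteq> {n. A n \<omega> \<le> y}"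
    using \<open>x < y\<close> by auto
  ultimately show ?case
    using elim by (simp add: points_in_def arrivals_upto_def card_Diff_subset)
qed

lemma points_in_measurable:
  assumes "\<And>n. A n \<in> borel_measurable M" "\<And>n. E n \<in> events"
  shows "points_in A E x y \<in> measurable M (count_space UNIV)"
proof -
  have "{\<omega> \<in> space M. A n \<omega> \<in> {x<..y} \<and> \<omega> \<in> E n} \<in> events" for n
    using assms(1)[of n] assms(2)[of n] by measurable
  then show ?thesis
    unfolding points_in_def[abs_def] by (intro measurable_card) simp
qed

text \<open>Without thinning, \<open>points_in\<close> is an increment of the counting process and therefore has a Poisson law.\<close>

lemma nn_integral_points_in_UNIV:
  assumes pp: "poisson_process M rate A" and "0 < rate" "0 \<le> x" "x < y"
    shows "(\<integral>\<^sup>+\<omega>. of_nat (f (points_in A (\<lambda>n. UNIV) x y \<omega>)) \<partial>M)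
      = (\<integral>\<^sup>+n. of_nat (f n) \<partial>measure_pmf (poisson_pmf (rate * (y - x))))"
proof -
  let ?N = "\<lambda>\<omega>. arrivals_upto A y \<omega> - arrivals_upto A x \<omega>"
  have [measurable]: "A n \<in> borel_measurable M" for n
    using pp by (simp add: poisson_process_def)
  have [measurable]: "?N \<in> measurable M (count_space UNIV)"
    unfolding arrivals_upto_def by measurable
  have law: "distr M (count_space UNIV) ?N = measure_pmf (poisson_pmf (rate * (y - x)))"
    using assms by (auto simp: poisson_process_def)
  have "(\<integral>\<^sup>+\<omega>. of_nat (f (points_in A (\<lambda>n. UNIV) x y \<omega>)) \<partial>M) = (\<integral>\<^sup>+\<omega>. of_nat (f (?N \<omega>)) \<partial>M)"
    using points_in_UNIV_eq_arrivals[OF pp \<open>x < y\<close>] by (intro nn_integral_cong_AE) auto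
  also have "\<dots> = (\<integral>\<^sup>+n. of_nat (f n) \<partial>distr M (count_space UNIV) ?N)"
    by (subst nn_integral_distr) auto
  finally show ?thesis
    unfolding law .
qed

text \<open>Expanding the counts into indicators turns both moments into series of probabilities that concern
  at most two points at a time, so that pairwise independence of the marks suffices below.\<close>

lemma nn_integral_points_in:
  assumes pp: "poisson_process M rate A" and E: "\<And>n. E n \<in> events"
  shows "(\<integral>\<^sup>+\<omega>. of_nat (points_in A E x y \<omega>) \<partial>M)
      = (\<Sum>n. emeasure M ({\<omega> \<in> space M. A n \<omega> \<in> {x<..y}} \<inter> E n))"
    and "(\<integral>\<^sup>+\<omega>. of_nat (points_in A E x y \<omega> * (points_in A E x y \<omega> - 1)) \<partial>M)
      = (\<Sum>n. \<Sum>m. if m = n then 0 else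
          emeasure M ({\<omega> \<in> space M. A n \<omega> \<in> {x<..y} \<and> A m \<omega> \<in> {x<..y}} \<inter> (E n \<inter> E m)))"
proof -
  define F where "F n = {\<omega> \<in> space M. A n \<omega> \<in> {x<..y}} \<inter> E n" for n
  have [measurable]: "A n \<in> borel_measurable M" for n
    using pp by (simp add: poisson_process_def)
  have [measurable]: "F n \<in> events" for n
    using E[of n] unfolding F_def by measurable
  define S where "S \<omega> = {n. A n \<omega> \<in> {x<..y} \<and> \<omega> \<in> E n}" for \<omega>
  have fin: "AE \<omega> in M. finite (S \<omega>) \<and> \<omega> \<in> space M"
    using poisson_process_finite[OF pp] AE_space
  proof eventually_elim
    case (elim \<omega>)
    then show ?case
      unfolding S_def by (intro conjI finite_subset[OF _ elim(1)[rule_format, of y]]) auto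
  qed
  have points: "points_in A E x y \<omega> = card (S \<omega>)" for \<omega>
    by (simp add: points_in_def S_def)
  have ind: "indicator (S \<omega>) n = (indicator (F n) \<omega> :: ennreal)" if "\<omega> \<in> space M" for \<omega> n
    using that by (auto simp: S_def F_def indicator_def)
  have "(\<integral>\<^sup>+\<omega>. of_nat (points_in A E x y \<omega>) \<partial>M) = (\<integral>\<^sup>+\<omega>. (\<Sum>n. indicator (F n) \<omega>) \<partial>M)"
    by (intro nn_integral_cong_AE eventually_mono[OF fin])
      (simp add: points suminf_indicator_card flip: ind)
  also have "\<dots> = (\<Sum>n. emeasure M (F n))"
    by (subst nn_integral_suminf) auto
  finally show "(\<integral>\<^sup>+\<omega>. of_nat (points_in A E x y \<omega>) \<partial>M)
      = (\<Sum>n. emeasure M ({\<omega> \<in> space M. A n \<omega> \<in> {x<..y}} \<inter> E n))"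
    by (simp add: F_def)
  have "(\<integral>\<^sup>+\<omega>. of_nat (points_in A E x y \<omega> * (points_in A E x y \<omega> - 1)) \<partial>M)
      = (\<integral>\<^sup>+\<omega>. (\<Sum>n. \<Sum>m. if m = n then 0 else indicator (F n) \<omega> * indicator (F m) \<omega>) \<partial>M)"
  proof (intro nn_integral_cong_AE eventually_mono[OF fin])
    fix \<omega> assume "finite (S \<omega>) \<and> \<omega> \<in> space M"
    then show "of_nat (points_in A E x y \<omega> * (points_in A E x y \<omega> - 1))
        = (\<Sum>n. \<Sum>m. if m = n then 0 else indicator (F n) \<omega> * indicator (F m) \<omega> :: ennreal)"
      using suminf_pairs_card[of "S \<omega>"] by (simp only: points ind)
  qed
  also have "\<dots> = (\<Sum>n. \<Sum>m. \<integral>\<^sup>+\<omega>. (if m = n then 0 else indicator (F n) \<omega> * indicator (F m) \<omega>) \<partial>M)"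
    by (subst nn_integral_suminf, simp, subst nn_integral_suminf) auto
  also have "\<dots> = (\<Sum>n. \<Sum>m. if m = n then 0 else emeasure M (F n \<inter> F m))"
    by (intro suminf_cong) (auto simp: indicator_inter_arith[symmetric])
  finally show "(\<integral>\<^sup>+\<omega>. of_nat (points_in A E x y \<omega> * (points_in A E x y \<omega> - 1)) \<partial>M)
      = (\<Sum>n. \<Sum>m. if m = n then 0 else
          emeasure M ({\<omega> \<in> space M. A n \<omega> \<in> {x<..y} \<and> A m \<omega> \<in> {x<..y}} \<inter> (E n \<inter> E m)))"
    unfolding F_def
    by (subst suminf_cong[OF suminf_cong]) (auto intro!: arg_cong[where f = "emeasure M"])
qed

text \<open>The events \<open>E n\<close> behave, for the first two moments of counts, like marks of probability \<open>q\<close> that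
  are independent of each other and of the points.\<close>

definition independent_thinning :: "(nat \<Rightarrow> 'a \<Rightarrow> real) \<Rightarrow> (nat \<Rightarrow> 'a set) \<Rightarrow> real \<Rightarrow> bool" where
  "independent_thinning A E q \<longleftrightarrow>
    (\<forall>n. E n \<in> events) \<and> 0 \<le> q \<and>
    (\<forall>n I. I \<in> sets borel \<longrightarrow>
       prob ({\<omega> \<in> space M. A n \<omega> \<in> I} \<inter> E n) = prob {\<omega> \<in> space M. A n \<omega> \<in> I} * q) \<and>
    (\<forall>n m I. n \<noteq> m \<longrightarrow> I \<in> sets borel \<longrightarrow>
       prob ({\<omega> \<in> space M. A n \<omega> \<in> I \<and> A m \<omega> \<in> I} \<inter> (E n \<inter> E m))
         = prob {\<omega> \<in> space M. A n \<omega> \<in> I \<and> A m \<omega> \<in> I} * q\<^sup>2)"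

text \<open>Thinning multiplies every term of the series for the mean by \<open>q\<close>, and the same series for the full
  process is the Poisson mean.\<close>

lemma thinned_points_mean:
  assumes pp: "poisson_process M rate A" and "0 < rate" "0 \<le> x" "x < y" and th: "independent_thinning A E q"
  shows "(\<integral>\<^sup>+\<omega>. of_nat (points_in A E x y \<omega>) \<partial>M) = ennreal (rate * (y - x) * q)"
proof -
  have E: "\<And>n. E n \<in> events" and "0 \<le> q"
    using th by (auto simp: independent_thinning_def)
  have "(\<integral>\<^sup>+\<omega>. of_nat (points_in A E x y \<omega>) \<partial>M)
      = (\<Sum>n. emeasure M ({\<omega> \<in> space M. A n \<omega> \<in> {x<..y}} \<inter> E n))"
    using pp E by (rule nn_integral_points_in)
  also have "\<dots> = (\<Sum>n. emeasure M {\<omega> \<in> space M. A n \<omega> \<in> {x<..y}} * ennreal q)"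
    using th by (simp add: independent_thinning_def emeasure_eq_measure ennreal_mult' del: greaterThanAtMost_iff)
  also have "\<dots> = (\<Sum>n. emeasure M ({\<omega> \<in> space M. A n \<omega> \<in> {x<..y}} \<inter> space M)) * ennreal q"
    by (simp add: Int_absorb2 subset_eq del: greaterThanAtMost_iff)
  also have "\<dots> = (\<integral>\<^sup>+\<omega>. of_nat (points_in A (\<lambda>_. space M) x y \<omega>) \<partial>M) * ennreal q"
    by (subst nn_integral_points_in[OF pp]) auto
  also have "(\<integral>\<^sup>+\<omega>. of_nat (points_in A (\<lambda>_. space M) x y \<omega>) \<partial>M)
     = (\<integral>\<^sup>+\<omega>. of_nat (points_in A (\<lambda>_. UNIV) x y \<omega>) \<partial>M)"
    by (intro nn_integral_cong) (simp add: points_in_def)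
  also have "\<dots> = ennreal (rate * (y - x))"
    using assms nn_integral_points_in_UNIV[OF pp, of x y "\<lambda>n. n"] by (simp add: poisson_mean)
  finally show ?thesis
    using \<open>0 \<le> q\<close> by (simp add: ennreal_mult'')
qed

text \<open>Each pair of distinct points is kept with probability \<open>q\<^sup>2\<close>, so the factorial moment is multiplied
  by \<open>q\<^sup>2\<close>.\<close>

lemma thinned_points_factorial_moment:
  assumes pp: "poisson_process M rate A" and "0 < rate" "0 \<le> x" "x < y" and th: "independent_thinning A E q"
  shows "(\<integral>\<^sup>+\<omega>. of_nat (points_in A E x y \<omega> * (points_in A E x y \<omega> - 1)) \<partial>M)
    = ennreal ((rate * (y - x) * q)\<^sup>2)"
proof -
  define J where "J n m = {\<omega> \<in> space M. A n \<omega> \<in> {x<..y} \<and> A m \<omega> \<in> {x<..y}}" for n m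
  have E: "\<And>n. E n \<in> events" and "0 \<le> q"
    using th by (auto simp: independent_thinning_def)
  have "(\<integral>\<^sup>+\<omega>. of_nat (points_in A E x y \<omega> * (points_in A E x y \<omega> - 1)) \<partial>M)
      = (\<Sum>n. \<Sum>m. if m = n then 0 else emeasure M (J n m \<inter> (E n \<inter> E m)))"
    unfolding J_def using pp E by (rule nn_integral_points_in)
  also have "\<dots> = (\<Sum>n. \<Sum>m. (if m = n then 0 else emeasure M (J n m)) * ennreal (q\<^sup>2))"
    using th by (intro suminf_cong)
      (simp add: independent_thinning_def emeasure_eq_measure ennreal_mult' J_def del: greaterThanAtMost_iff)
  also have "\<dots> = (\<Sum>n. \<Sum>m. if m = n then 0 else emeasure M (J n m \<inter> (space M \<inter> space M))) * ennreal (q\<^sup>2)"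
    unfolding ennreal_suminf_multc
    by (intro arg_cong2[where f = "(*)"] suminf_cong refl) (auto simp: J_def intro!: arg_cong[where f = "emeasure M"])
  also have "\<dots> = (\<integral>\<^sup>+\<omega>. of_nat (points_in A (\<lambda>_. space M) x y \<omega> * (points_in A (\<lambda>_. space M) x y \<omega> - 1)) \<partial>M)
      * ennreal (q\<^sup>2)"
    unfolding J_def by (subst nn_integral_points_in(2)[OF pp]) auto
  also have "(\<integral>\<^sup>+\<omega>. of_nat (points_in A (\<lambda>_. space M) x y \<omega> * (points_in A (\<lambda>_. space M) x y \<omega> - 1)) \<partial>M)
     = (\<integral>\<^sup>+\<omega>. of_nat (points_in A (\<lambda>_. UNIV) x y \<omega> * (points_in A (\<lambda>_. UNIV) x y \<omega> - 1)) \<partial>M)"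
    by (intro nn_integral_cong) (simp add: points_in_def)
  also have "\<dots> = ennreal ((rate * (y - x))\<^sup>2)"
    using assms nn_integral_points_in_UNIV[OF pp, of x y "\<lambda>n. n * (n - 1)"]
    by (simp add: poisson_factorial_moment[simplified])
  finally show ?thesis
    by (simp add: ennreal_mult'' power_mult_distrib)
qed

text \<open>By the two preceding moments the variance of the thinned count equals its mean, as for a Poisson
  variable, and Chebyshev's inequality applies.\<close>

lemma thinned_points_deviation:
  assumes pp: "poisson_process M rate A" and "0 < rate" "0 \<le> x" "x < y" and th: "independent_thinning A E q"
    and "0 < \<eta>"
  shows "prob {\<omega> \<in> space M. \<eta> \<le> \<bar>real (points_in A E x y \<omega>) - rate * (y - x) * q\<bar>}
    \<le> rate * (y - x) * q / \<eta>\<^sup>2"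
proof -
  define N where "N = points_in A E x y"
  define m where "m = rate * (y - x) * q"
  have "0 \<le> m"
    using assms by (auto simp: m_def independent_thinning_def)
  have [measurable]: "N \<in> measurable M (count_space UNIV)"
    unfolding N_def using pp th by (intro points_in_measurable) (auto simp: poisson_process_def independent_thinning_def)
  have 1: "(\<integral>\<^sup>+\<omega>. ennreal (real (N \<omega>)) \<partial>M) = ennreal m"
    using thinned_points_mean[OF assms(1-5)] by (simp add: N_def m_def ennreal_of_nat_eq_real_of_nat)
  have sq: "(real k)\<^sup>2 = real (k * (k - 1)) + real k" for k :: nat
    by (cases k) (auto simp: power2_eq_square algebra_simps)
  have "(\<integral>\<^sup>+\<omega>. ennreal ((real (N \<omega>))\<^sup>2) \<partial>M)
      = (\<integral>\<^sup>+\<omega>. of_nat (N \<omega> * (N \<omega> - 1)) + of_nat (N \<omega>) \<partial>M)"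
    by (simp add: sq ennreal_of_nat_eq_real_of_nat del: of_nat_mult)
  also have "\<dots> = (\<integral>\<^sup>+\<omega>. of_nat (N \<omega> * (N \<omega> - 1)) \<partial>M) + (\<integral>\<^sup>+\<omega>. of_nat (N \<omega>) \<partial>M)"
    by (rule nn_integral_add) auto
  also have "\<dots> = ennreal (m\<^sup>2 + m)"
    using \<open>0 \<le> m\<close> thinned_points_mean[OF assms(1-5)] thinned_points_factorial_moment[OF assms(1-5)]
    by (simp only: N_def m_def) simp
  finally have 2: "(\<integral>\<^sup>+\<omega>. ennreal ((real (N \<omega>))\<^sup>2) \<partial>M) = ennreal (m\<^sup>2 + m)" .
  have int: "integrable M (\<lambda>\<omega>. real (N \<omega>))" "integrable M (\<lambda>\<omega>. (real (N \<omega>))\<^sup>2)"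
    using 1 2 by (auto intro!: integrableI_nonneg)
  have ex: "expectation (\<lambda>\<omega>. real (N \<omega>)) = m" "expectation (\<lambda>\<omega>. (real (N \<omega>))\<^sup>2) = m\<^sup>2 + m"
    using 1 2 \<open>0 \<le> m\<close> by (auto simp: integral_eq_nn_integral simp del: ennreal_plus)
  have "variance (\<lambda>\<omega>. real (N \<omega>)) = m"
    using variance_eq[OF int] unfolding ex by simp
  moreover have "random_variable borel (\<lambda>\<omega>. real (N \<omega>))"
    by measurable
  ultimately show ?thesis
    using Chebyshev_inequality[of "\<lambda>\<omega>. real (N \<omega>)" \<eta>] int(2) \<open>0 < \<eta>\<close> ex(1) by (simp add: N_def m_def)
qed

end

section \<open>Marks of customers in a reservation system\<close>

context reservation_system
begin

abbreviation marked :: "nat \<Rightarrow> nat \<times> nat \<Rightarrow> real \<Rightarrow> nat \<Rightarrow> 'w set" where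
  "marked k q \<beta> n \<equiv> {\<omega> \<in> space P. X k n \<omega> = q \<and> U k n \<omega> < \<beta>}"

lemma request_prob:
  assumes "k \<in> {1..M}"
  shows "{\<omega> \<in> space P. X k n \<omega> = q} \<in> events" "prob {\<omega> \<in> space P. X k n \<omega> = q} = pmf (G k) q"
proof -
  have [measurable]: "X k n \<in> measurable P (count_space UNIV)"
    using request_measurable[OF assms] .
  show "{\<omega> \<in> space P. X k n \<omega> = q} \<in> events"
    by measurable
  have "measure (distr P (count_space UNIV) (X k n)) {q} = prob (X k n -` {q} \<inter> space P)"
    by (rule measure_distr) auto
  also have "X k n -` {q} \<inter> space P = {\<omega> \<in> space P. X k n \<omega> = q}"
    by auto
  finally show "prob {\<omega> \<in> space P. X k n \<omega> = q} = pmf (G k) q"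
    using request_law[OF assms] by (simp add: measure_pmf_single)
qed

lemma coin_prob:
  assumes "k \<in> {1..M}" "0 \<le> \<beta>" "\<beta> \<le> 1"
  shows "{\<omega> \<in> space P. U k n \<omega> < \<beta>} \<in> events" "prob {\<omega> \<in> space P. U k n \<omega> < \<beta>} = \<beta>"
proof -
  have [measurable]: "U k n \<in> borel_measurable P"
    using coin_measurable[OF assms(1)] .
  show "{\<omega> \<in> space P. U k n \<omega> < \<beta>} \<in> events"
    by measurable
  have "measure (distr P lborel (U k n)) {..<\<beta>} = prob (U k n -` {..<\<beta>} \<inter> space P)"
    by (rule measure_distr) auto
  also have "U k n -` {..<\<beta>} \<inter> space P = {\<omega> \<in> space P. U k n \<omega> < \<beta>}"
    by auto
  also have "measure (distr P lborel (U k n)) {..<\<beta>} = measure lborel ({0..1} \<inter> {..<\<beta>}) / measure lborel {0..1::real}"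
    unfolding coin_law[OF assms(1)] by (rule measure_uniform_measure) auto
  also have "{0..1} \<inter> {..<\<beta>} = {0..<\<beta>}"
    using assms by auto
  finally show "prob {\<omega> \<in> space P. U k n \<omega> < \<beta>} = \<beta>"
    using assms by simp
qed

text \<open>The request and the coin of a customer are independent of each other, of those of other customers
  and of the arrival epochs. Hence the customers of one class with a given request and a coin below
  \<open>\<beta>\<close> form an independent thinning of the arrival process of that class.\<close>

lemma marked_thinning:
  assumes k: "k \<in> {1..M}" and \<beta>: "0 \<le> \<beta>" "\<beta> \<le> 1"
  shows "independent_thinning (A k) (marked k q \<beta>) (pmf (G k) q * \<beta>)"
proof -
  note rp = request_prob[OF k] and cp = coin_prob[OF assms]
  define R where "R i = {\<omega> \<in> space P. X k i \<omega> = q}" for i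
  define W where "W i = {\<omega> \<in> space P. U k i \<omega> < \<beta>}" for i
  have marked: "marked k q \<beta> i = R i \<inter> W i" for i
    by (auto simp: R_def W_def)
  have R: "R i \<in> source_events P A X U (Request k i)" for i
    unfolding R_def using in_vimage_algebra[of "{q}" "count_space UNIV" "X k i" "space P"]
    by (auto simp: vimage_def Int_def conj_commute)
  have W: "W i \<in> source_events P A X U (Coin k i)" for i
    unfolding W_def using in_vimage_algebra[of "{..<\<beta>}" borel "U k i" "space P"]
    by (auto simp: vimage_def Int_def conj_commute)
  have D: "{\<omega> \<in> space P. A k n \<omega> \<in> I \<and> A k m \<omega> \<in> I} \<in> source_events P A X U (Arrivals k)"
    if "I \<in> sets borel" for n m I
  proof -
    have "{f \<in> space (Pi\<^sub>M UNIV (\<lambda>_. borel)). f n \<in> I \<and> f m \<in> I} \<in> sets (Pi\<^sub>M (UNIV::nat set) (\<lambda>_. borel::real measure))"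
      using that by measurable
    from in_vimage_algebra[OF this, of "\<lambda>\<omega> n. A k n \<omega>" "space P"] show ?thesis
      by (simp add: vimage_def Int_def conj_commute space_PiM)
  qed
  \<comment> \<open>An event for every source: \<open>D\<close> for arrivals, the prescribed request and coin events otherwise.\<close>
  define F where "F D s = (case s of Arrivals _ \<Rightarrow> D | Request _ i \<Rightarrow> R i | Coin _ i \<Rightarrow> W i)" for D s
  have ind: "prob (\<Inter>s\<in>J. F D s) = (\<Prod>s\<in>J. prob (F D s))"
    if "D \<in> source_events P A X U (Arrivals k)" "finite J" "J \<noteq> {}"
      "J \<subseteq> {Arrivals k} \<union> range (Request k) \<union> range (Coin k)" for D J
  proof (rule indep_setsD[OF independence _ that(3,2)])
    show "J \<subseteq> Arrivals ` {1..M} \<union> case_prod Request ` ({1..M} \<times> UNIV) \<union> case_prod Coin ` ({1..M} \<times> UNIV)"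
      using that(4) k by force
    show "\<forall>s\<in>J. F D s \<in> source_events P A X U s"
      using that(1,4) R W by (auto simp: F_def simp del: source_events.simps)
  qed
  have 1: "prob (D \<inter> (R n \<inter> W n)) = prob D * (pmf (G k) q * \<beta>)"
    if D: "D \<in> source_events P A X U (Arrivals k)" for D n
    using ind[OF D, of "{Arrivals k, Request k n, Coin k n}"] rp(2)[of n q] cp(2)[of n]
    by (simp add: F_def R_def W_def)
  have 2: "prob (D \<inter> ((R n \<inter> W n) \<inter> (R m \<inter> W m))) = prob D * (pmf (G k) q * \<beta>)\<^sup>2"
    if D: "D \<in> source_events P A X U (Arrivals k)" and "n \<noteq> m" for D n m
    using ind[OF D, of "{Arrivals k, Request k n, Coin k n, Request k m, Coin k m}"] \<open>n \<noteq> m\<close>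
      rp(2)[of n q] cp(2)[of n] rp(2)[of m q] cp(2)[of m]
    by (simp add: F_def R_def W_def power2_eq_square Int_assoc)
  have ev: "marked k q \<beta> n \<in> events" for n
    unfolding marked using rp(1) cp(1) by (auto simp: R_def W_def)
  show ?thesis
    unfolding independent_thinning_def marked
  proof (intro conjI allI impI)
    show "R n \<inter> W n \<in> events" for n
      using ev marked by simp
    show "0 \<le> pmf (G k) q * \<beta>"
      using \<beta> by simp
    show "prob ({\<omega> \<in> space P. A k n \<omega> \<in> I} \<inter> (R n \<inter> W n)) = prob {\<omega> \<in> space P. A k n \<omega> \<in> I} * (pmf (G k) q * \<beta>)"
      if "I \<in> sets borel" for n I
      using 1[OF D[OF that, of n n]] by simp
    show "prob ({\<omega> \<in> space P. A k n \<omega> \<in> I \<and> A k m \<omega> \<in> I} \<inter> ((R n \<inter> W n) \<inter> (R m \<inter> W m)))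
        = prob {\<omega> \<in> space P. A k n \<omega> \<in> I \<and> A k m \<omega> \<in> I} * (pmf (G k) q * \<beta>)\<^sup>2"
      if "n \<noteq> m" "I \<in> sets borel" for n m I
      using 2[OF D[OF that(2)] that(1)] .
  qed
qed

lemma request_AE:
  assumes "k \<in> {1..M}"
  shows "AE \<omega> in P. \<forall>n. X k n \<omega> \<in> set_pmf (G k)"
proof -
  have "AE \<omega> in P. X k n \<omega> \<in> set_pmf (G k)" for n
  proof -
    have "AE q in distr P (count_space UNIV) (X k n). q \<in> set_pmf (G k)"
      unfolding request_law[OF assms] by (rule AE_measure_pmf)
    then show ?thesis
      using request_measurable[OF assms] by (simp add: AE_distr_iff)
  qed
  then show ?thesis
    by (simp add: AE_all_countable)
qed

lemma coin_AE:
  assumes "k \<in> {1..M}"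
  shows "AE \<omega> in P. \<forall>n. U k n \<omega> < 1"
proof -
  have "AE \<omega> in P. U k n \<omega> < 1" for n
    using prob_eq_1[OF coin_prob(1)[OF assms, of 1]] coin_prob(2)[OF assms, of 1] by auto
  then show ?thesis
    by (simp add: AE_all_countable)
qed

end

section \<open>Sample paths of the class selection policy\<close>

definition request_types :: "nat \<Rightarrow> (nat \<Rightarrow> nat) \<Rightarrow> (nat \<Rightarrow> nat) \<Rightarrow> (nat \<times> nat \<times> nat) set" where
  "request_types M u v = (SIGMA k:{1..M}. {0..u k} \<times> {1..v k})"

lemma finite_request_types [simp]: "finite (request_types M u v)"
  by (simp add: request_types_def)

text \<open>Counts the arrivals of type \<open>\<tau>\<close> in \<open>(x, y]\<close> whose coin admits them at acceptance probabilities \<open>\<phi>\<close>,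
  regardless of capacity.\<close>

definition type_count ::
  "(customer \<Rightarrow> real) \<Rightarrow> (customer \<Rightarrow> nat \<times> nat) \<Rightarrow> (customer \<Rightarrow> real) \<Rightarrow> (nat \<Rightarrow> real) \<Rightarrow>
   nat \<times> nat \<times> nat \<Rightarrow> real \<Rightarrow> real \<Rightarrow> nat"
where
  "type_count a q w \<phi> \<tau> x y =
     card {n. a (fst \<tau>, n) \<in> {x<..y} \<and> q (fst \<tau>, n) = snd \<tau> \<and> w (fst \<tau>, n) < \<phi> (fst \<tau>)}"

text \<open>For \<open>z\<close> in the \<open>m\<close>-th cell \<open>(m h, (m + 1) h]\<close>, a customer of type \<open>(k, d, s)\<close> whose requested
  interval contains \<open>z\<close> has arrived in the window from \<open>m h - d - s\<close> to \<open>(m + 1) h - d\<close>. The cells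
  \<open>j, ..., j + J\<close> contain all times that a customer arriving in cell \<open>j\<close> can request, provided that
  \<open>d + s \<le> J h\<close>. The arrival rates of the admitted customers of each type are given by \<open>\<mu>\<close>.\<close>

definition typical_cell ::
  "(nat \<times> nat \<times> nat) set \<Rightarrow> (customer \<Rightarrow> real) \<Rightarrow> (customer \<Rightarrow> nat \<times> nat) \<Rightarrow> (customer \<Rightarrow> real) \<Rightarrow>
   (nat \<Rightarrow> real) \<Rightarrow> (nat \<times> nat \<times> nat \<Rightarrow> real) \<Rightarrow> real \<Rightarrow> real \<Rightarrow> nat \<Rightarrow> nat \<Rightarrow> bool"
where
  "typical_cell Ts a q w \<phi> \<mu> h \<eta> J j \<longleftrightarrow>
     (\<forall>(k, d, s)\<in>Ts.
        \<bar>real (type_count a q w \<phi> (k, d, s) (real j * h) (real (Suc j) * h)) - \<mu> (k, d, s) * h\<bar> < \<eta> \<and>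
        (\<forall>m\<in>{j..j + J}.
          \<bar>real (type_count a q w \<phi> (k, d, s) (real m * h - real d - real s) (real (Suc m) * h - real d))
            - \<mu> (k, d, s) * (real s + h)\<bar> < \<eta>))"

lemma service_time_within_nonneg: "0 \<le> service_time_within T t q"
  by (simp add: service_time_within_def split: prod.split)

lemma service_time_within_le: "service_time_within T t (d, s) \<le> real s"
  by (auto simp: service_time_within_def)

lemma service_time_within_eq:
  assumes "0 \<le> t" "t + real d + real s \<le> T"
  shows "service_time_within T t (d, s) = real s"
proof -
  have "{t + real d .. t + real d + real s} \<inter> {0..T} = {t + real d .. t + real d + real s}"
    using assms by (intro Int_absorb2) auto
  then show ?thesis
    unfolding service_time_within_def prod.case by (simp only:) simp
qed

text \<open>The index is the ceiling of \<open>z / h\<close> minus 1, as cells are open on the left.\<close>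

lemma grid_cell_exists:
  assumes "0 < h" "real j * h < z" "z \<le> real (Suc (j + J)) * h"
  obtains m where "m \<in> {j..j + J}" "real m * h < z" "z \<le> real (Suc m) * h"
proof -
  define i where "i = \<lceil>z / h\<rceil>"
  have i: "real_of_int i - 1 < z / h" "z / h \<le> real_of_int i"
    unfolding i_def by linarith+
  have "real j < z / h" "z / h \<le> real (Suc (j + J))"
    using assms by (simp_all add: pos_less_divide_eq pos_divide_le_eq)
  then have "int j < i" "i \<le> int (Suc (j + J))"
    unfolding i_def by linarith+
  then have "nat (i - 1) \<in> {j..j + J}" and n: "real (nat (i - 1)) = real_of_int i - 1"
    by auto
  moreover have "real (nat (i - 1)) * h < z" "z \<le> real (Suc (nat (i - 1))) * h"
    using i \<open>0 < h\<close> n by (simp_all add: pos_less_divide_eq pos_divide_le_eq)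
  ultimately show thesis
    using that by blast
qed

text \<open>The properties that almost every sample path has.\<close>

locale sample_path =
  fixes M :: nat and u v :: "nat \<Rightarrow> nat"
    and a :: "customer \<Rightarrow> real" and q :: "customer \<Rightarrow> nat \<times> nat" and w :: "customer \<Rightarrow> real"
  assumes arrival_pos: "c \<in> customers M \<Longrightarrow> 0 < a c"
    and finite_before: "finite {c \<in> customers M. a c \<le> t}"
    and request_bounds: "c \<in> customers M \<Longrightarrow> q c \<in> {0..u (fst c)} \<times> {1..v (fst c)}"
    and coin_less_1: "c \<in> customers M \<Longrightarrow> w c < 1"
begin

abbreviation "Ts \<equiv> request_types M u v"

text \<open>Revenues and occupancies are sums over customers that depend on their types only.\<close>

lemma sum_by_type:
  fixes f :: "nat \<times> nat \<times> nat \<Rightarrow> real"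
  assumes "finite S" "S \<subseteq> customers M"
  shows "(\<Sum>c\<in>S. f (fst c, q c))
    = (\<Sum>\<tau>\<in>Ts. f \<tau> * real (card {n. (fst \<tau>, n) \<in> S \<and> q (fst \<tau>, n) = snd \<tau>}))"
proof -
  have "(\<lambda>c. (fst c, q c)) ` S \<subseteq> Ts"
    using assms(2) request_bounds by (force simp: request_types_def customers_def)
  then have "(\<Sum>c\<in>S. f (fst c, q c)) = (\<Sum>\<tau>\<in>Ts. \<Sum>c\<in>{c \<in> S. (fst c, q c) = \<tau>}. f (fst c, q c))"
    using assms(1) by (intro sum.group[symmetric]) auto
  also have "\<dots> = (\<Sum>\<tau>\<in>Ts. f \<tau> * real (card {n. (fst \<tau>, n) \<in> S \<and> q (fst \<tau>, n) = snd \<tau>}))"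
  proof (rule sum.cong[OF refl])
    fix \<tau>
    have "{c \<in> S. (fst c, q c) = \<tau>} = Pair (fst \<tau>) ` {n. (fst \<tau>, n) \<in> S \<and> q (fst \<tau>, n) = snd \<tau>}"
      by (cases \<tau>) auto
    then have "card {c \<in> S. (fst c, q c) = \<tau>} = card {n. (fst \<tau>, n) \<in> S \<and> q (fst \<tau>, n) = snd \<tau>}"
      by (simp add: card_image inj_on_def)
    then show "(\<Sum>c\<in>{c \<in> S. (fst c, q c) = \<tau>}. f (fst c, q c))
        = f \<tau> * real (card {n. (fst \<tau>, n) \<in> S \<and> q (fst \<tau>, n) = snd \<tau>})"
      by (simp add: mult.commute)
  qed
  finally show ?thesis .
qed

lemma finite_class_before:
  assumes "k \<in> {1..M}"
  shows "finite {n. a (k, n) \<le> t}"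
proof (rule finite_imageD)
  show "finite (Pair k ` {n. a (k, n) \<le> t})"
    using assms by (intro finite_subset[OF _ finite_before[of t]]) (auto simp: customers_def)
qed (simp add: inj_on_def)

lemma accepted_below_subset:
  "accepted_below M \<pi> a q w j \<subseteq> {c \<in> customers M. \<exists>x. w c < \<pi> x (fst c) (q c)}"
  by (induction j) auto

lemma accepted_subset: "accepted M \<pi> a q w \<subseteq> {c \<in> customers M. \<exists>x. w c < \<pi> x (fst c) (q c)}"
  unfolding accepted_def using accepted_below_subset by blast

text \<open>Every policy earns at most the full payment of all customers who arrive up to \<open>T\<close>. The count uses
  acceptance probability 1, which admits everybody because coins are below 1.\<close>

lemma path_revenue_le:
  assumes r: "\<And>k. k \<in> {1..M} \<Longrightarrow> 0 \<le> r k"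
  shows "path_revenue M r \<pi> a q w T
    \<le> (\<Sum>(k, d, s)\<in>Ts. r k * real s * real (type_count a q w (\<lambda>_. 1) (k, d, s) 0 T))"
proof -
  define S where "S = {c \<in> customers M. a c \<le> T}"
  have fin: "finite S" and sub: "S \<subseteq> customers M"
    using finite_before by (auto simp: S_def)
  have "path_revenue M r \<pi> a q w T \<le> (\<Sum>c\<in>{c \<in> accepted M \<pi> a q w. a c \<le> T}. r (fst c) * real (snd (q c)))"
    unfolding path_revenue_def
  proof (intro sum_mono mult_left_mono r)
    fix c assume c: "c \<in> {c \<in> accepted M \<pi> a q w. a c \<le> T}"
    show "service_time_within T (a c) (q c) \<le> real (snd (q c))"
      using service_time_within_le[of T "a c" "fst (q c)" "snd (q c)"] by simp
    show "fst c \<in> {1..M}"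
      using c accepted_subset[of \<pi>] by (auto simp: customers_def)
  qed
  also have "\<dots> \<le> (\<Sum>c\<in>S. r (fst c) * real (snd (q c)))"
    using fin accepted_subset[of \<pi>] r by (intro sum_mono2) (auto simp: S_def customers_def)
  also have "\<dots> = (\<Sum>c\<in>S. (\<lambda>(k, d, s). r k * real s) (fst c, q c))"
    by (simp add: case_prod_beta)
  also have "\<dots> = (\<Sum>\<tau>\<in>Ts. (\<lambda>(k, d, s). r k * real s) \<tau> * real (card {n. (fst \<tau>, n) \<in> S \<and> q (fst \<tau>, n) = snd \<tau>}))"
    using fin sub by (rule sum_by_type)
  also have "\<dots> = (\<Sum>(k, d, s)\<in>Ts. r k * real s * real (type_count a q w (\<lambda>_. 1) (k, d, s) 0 T))"
  proof (intro sum.cong refl)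
    fix \<tau> assume "\<tau> \<in> Ts"
    then obtain k d s where \<tau>: "\<tau> = (k, d, s)" and k: "k \<in> {1..M}"
      by (auto simp: request_types_def)
    from k have "(k, n) \<in> customers M" for n
      by (simp add: customers_def)
    then have "{n. (k, n) \<in> S \<and> q (k, n) = (d, s)} = {n. a (k, n) \<in> {0<..T} \<and> q (k, n) = (d, s) \<and> w (k, n) < 1}"
      using arrival_pos coin_less_1 by (auto simp: S_def)
    then show "(\<lambda>(k, d, s). r k * real s) \<tau> * real (card {n. (fst \<tau>, n) \<in> S \<and> q (fst \<tau>, n) = snd \<tau>})
       = (case \<tau> of (k, d, s) \<Rightarrow> r k * real s * real (type_count a q w (\<lambda>_. 1) (k, d, s) 0 T))"
      by (simp add: \<tau> type_count_def)
  qed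
  finally show ?thesis .
qed

text \<open>The willing customers form the system without capacity limit that dominates the ICSP.\<close>

definition willing :: "(nat \<Rightarrow> real) \<Rightarrow> customer set" where
  "willing \<phi> = {c \<in> customers M. w c < \<phi> (fst c)}"

definition occupying :: "(nat \<Rightarrow> real) \<Rightarrow> real \<Rightarrow> customer set" where
  "occupying \<phi> z = {c \<in> willing \<phi>. z \<in> {a c + real (fst (q c)) .. a c + real (fst (q c)) + real (snd (q c))}}"

lemma finite_occupying: "finite (occupying \<phi> z)"
  by (rule finite_subset[OF _ finite_before[of z]]) (auto simp: occupying_def willing_def)

text \<open>Bookings in the state are willing customers, and shifting by the current time \<open>t\<close> turns their
  relative intervals into absolute ones.\<close>

lemma reserved_state_at_le:
  assumes "B \<subseteq> willing \<phi>"
  shows "reserved (state_at a q B t) y \<le> card (occupying \<phi> (t + y))"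
proof (cases "finite {c \<in> B. t \<le> a c + real (fst (q c)) + real (snd (q c))}")
  case True
  then have "reserved (state_at a q B t) y = card {c \<in> {c \<in> B. t \<le> a c + real (fst (q c)) + real (snd (q c))}.
      y \<in> {real (fst (q c)) - (t - a c) .. real (fst (q c)) - (t - a c) + real (snd (q c))}}"
    by (simp add: reserved_def state_at_def filter_mset_image_mset case_prod_beta)
  also have "\<dots> \<le> card (occupying \<phi> (t + y))"
    using assms by (intro card_mono finite_occupying) (auto simp: occupying_def)
  finally show ?thesis .
next
  \<comment> \<open>The multiset of an infinite set is empty by convention, so nothing is reserved.\<close>
  case False
  then show ?thesis
    by (simp add: reserved_def state_at_def)
qed

text \<open>The ICSP turns a willing customer away only if the requested interval is full, and occupancy by
  accepted customers is at most occupancy by willing customers.\<close>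

lemma icsp_accepts:
  assumes "0 \<le> \<alpha>" and c: "c \<in> willing (class_fraction M' \<alpha>)"
    and room: "\<And>z. a c + real (fst (q c)) \<le> z \<Longrightarrow> z \<le> a c + real (fst (q c)) + real (snd (q c)) \<Longrightarrow>
      card (occupying (class_fraction M' \<alpha>) z) < C"
  shows "c \<in> accepted M (icsp C M' \<alpha>) a q w"
proof -
  define B where "B = accepted_below M (icsp C M' \<alpha>) a q w (rank M a c)"
  obtain d s where q: "q c = (d, s)"
    by force
  have "icsp C M' \<alpha> x k b \<le> class_fraction M' \<alpha> k" for x k b
    using \<open>0 \<le> \<alpha>\<close> by (simp add: icsp_def class_fraction_def)
  then have "B \<subseteq> willing (class_fraction M' \<alpha>)"
  proof (intro subsetI)
    fix c' assume le: "\<And>x k b. icsp C M' \<alpha> x k b \<le> class_fraction M' \<alpha> k" and "c' \<in> B"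
    then obtain x where "c' \<in> customers M" "w c' < icsp C M' \<alpha> x (fst c') (q c')"
      unfolding B_def using accepted_below_subset[of "icsp C M' \<alpha>" "rank M a c"] by blast
    with le[of x "fst c'" "q c'"] show "c' \<in> willing (class_fraction M' \<alpha>)"
      by (simp add: willing_def)
  qed
  then have "reserved (state_at a q B (a c)) y < C" if "y \<in> {real d..real d + real s}" for y
    using room[of "a c + y"] that by (intro le_less_trans[OF reserved_state_at_le]) (auto simp: q)
  then have "max_reserved (state_at a q B (a c)) (q c) < C"
    by (simp add: q max_reserved_less_iff)
  then have "c \<in> accepted_below M (icsp C M' \<alpha>) a q w (Suc (rank M a c))"
    using c by (simp add: willing_def icsp_def flip: B_def)
  then show ?thesis
    unfolding accepted_def by blast
qed

text \<open>The occupancy at any time of a cell is bounded by the window counts of that cell, uniformly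
  over the continuum of times in it.\<close>

lemma card_occupying_le:
  assumes "real m * h < z" "z \<le> real (Suc m) * h"
  shows "real (card (occupying \<phi> z))
    \<le> (\<Sum>(k, d, s)\<in>Ts. real (type_count a q w \<phi> (k, d, s) (real m * h - real d - real s) (real (Suc m) * h - real d)))"
proof -
  have "real (card (occupying \<phi> z)) = (\<Sum>c\<in>occupying \<phi> z. (\<lambda>_. 1) (fst c, q c))"
    by simp
  also have "\<dots> = (\<Sum>\<tau>\<in>Ts. 1 * real (card {n. (fst \<tau>, n) \<in> occupying \<phi> z \<and> q (fst \<tau>, n) = snd \<tau>}))"
    by (rule sum_by_type[OF finite_occupying]) (auto simp: occupying_def willing_def)
  also have "\<dots> \<le> (\<Sum>(k, d, s)\<in>Ts. real (type_count a q w \<phi> (k, d, s) (real m * h - real d - real s) (real (Suc m) * h - real d)))"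
  proof (rule sum_mono)
    fix \<tau> assume "\<tau> \<in> Ts"
    then obtain k d s where \<tau>: "\<tau> = (k, d, s)" and k: "k \<in> {1..M}"
      by (auto simp: request_types_def)
    have "card {n. (k, n) \<in> occupying \<phi> z \<and> q (k, n) = (d, s)}
        \<le> type_count a q w \<phi> (k, d, s) (real m * h - real d - real s) (real (Suc m) * h - real d)"
      unfolding type_count_def
    proof (rule card_mono)
      show "finite {n. a (fst (k, d, s), n) \<in> {real m * h - real d - real s<..real (Suc m) * h - real d} \<and>
          q (fst (k, d, s), n) = snd (k, d, s) \<and> w (fst (k, d, s), n) < \<phi> (fst (k, d, s))}"
        by (rule finite_subset[OF _ finite_class_before[OF k, of "real (Suc m) * h - real d"]]) auto
    qed (use assms in \<open>auto simp: occupying_def willing_def\<close>)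
    then show "1 * real (card {n. (fst \<tau>, n) \<in> occupying \<phi> z \<and> q (fst \<tau>, n) = snd \<tau>})
      \<le> (case \<tau> of (k, d, s) \<Rightarrow> real (type_count a q w \<phi> (k, d, s) (real m * h - real d - real s) (real (Suc m) * h - real d)))"
      by (simp add: \<tau>)
  qed
  finally show ?thesis .
qed

text \<open>Any time requested by a customer from cell \<open>j\<close> lies in one of the cells \<open>j, ..., j + J\<close>, where in the
  typical case fewer than \<open>C\<close> willing customers can occupy units.\<close>

lemma accepted_in_typical_cell:
  assumes "0 < h" "0 \<le> \<alpha>"
    and typical: "typical_cell Ts a q w (class_fraction M' \<alpha>) \<mu> h \<eta> J j"
    and load: "(\<Sum>(k, d, s)\<in>Ts. \<mu> (k, d, s) * (real s + h) + \<eta>) \<le> real C"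
    and J: "\<And>k d s. (k, d, s) \<in> Ts \<Longrightarrow> real d + real s \<le> real J * h"
    and c: "c \<in> willing (class_fraction M' \<alpha>)" "a c \<in> {real j * h<..real (Suc j) * h}"
  shows "c \<in> accepted M (icsp C M' \<alpha>) a q w"
proof (rule icsp_accepts[OF \<open>0 \<le> \<alpha>\<close> c(1)])
  fix z assume z: "a c + real (fst (q c)) \<le> z" "z \<le> a c + real (fst (q c)) + real (snd (q c))"
  let ?N = "\<lambda>m. \<lambda>(k, d, s). real (type_count a q w (class_fraction M' \<alpha>) (k, d, s)
       (real m * h - real d - real s) (real (Suc m) * h - real d))"
  have in_Ts: "(fst c, q c) \<in> Ts"
    using c(1) request_bounds[of c] by (auto simp: willing_def request_types_def customers_def)
  then have "real (fst (q c)) + real (snd (q c)) \<le> real J * h"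
    using J[of "fst c" "fst (q c)" "snd (q c)"] by simp
  then have "z \<le> real (Suc (j + J)) * h" "real j * h < z"
    using z c(2) by (auto simp: algebra_simps)
  then obtain m where m: "m \<in> {j..j + J}" "real m * h < z" "z \<le> real (Suc m) * h"
    using grid_cell_exists[OF \<open>0 < h\<close>] by metis
  have "real (card (occupying (class_fraction M' \<alpha>) z)) \<le> (\<Sum>\<tau>\<in>Ts. ?N m \<tau>)"
    using card_occupying_le[OF m(2,3)] by simp
  also have "\<dots> < (\<Sum>(k, d, s)\<in>Ts. \<mu> (k, d, s) * (real s + h) + \<eta>)"
  proof (rule sum_strict_mono)
    fix \<tau> assume "\<tau> \<in> Ts"
    then show "?N m \<tau> < (case \<tau> of (k, d, s) \<Rightarrow> \<mu> (k, d, s) * (real s + h) + \<eta>)"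
      using typical m(1) unfolding typical_cell_def by (cases \<tau>) fastforce
  qed (use in_Ts in auto)
  finally show "card (occupying (class_fraction M' \<alpha>) z) < C"
    using load by simp
qed

text \<open>In a typical cell all willing customers are accepted, and there are at least as many of each type
  as the mean minus \<open>\<eta>\<close>. Cells that end at least \<open>J h\<close> before \<open>T\<close> are used since their customers have
  completed service by \<open>T\<close>.\<close>

lemma path_revenue_icsp_ge:
  assumes "0 < h" "0 \<le> \<alpha>"
    and load: "(\<Sum>(k, d, s)\<in>Ts. \<mu> (k, d, s) * (real s + h) + \<eta>) \<le> real C"
    and J: "\<And>k d s. (k, d, s) \<in> Ts \<Longrightarrow> real d + real s \<le> real J * h"
    and r: "\<And>k. k \<in> {1..M} \<Longrightarrow> 0 \<le> r k"
    and K: "finite K" "\<And>j. j \<in> K \<Longrightarrow> real (Suc j + J) * h \<le> T"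
  shows "(\<Sum>j\<in>K. if typical_cell Ts a q w (class_fraction M' \<alpha>) \<mu> h \<eta> J j
        then \<Sum>(k, d, s)\<in>Ts. r k * real s * (\<mu> (k, d, s) * h - \<eta>) else 0)
    \<le> path_revenue M r (icsp C M' \<alpha>) a q w T"
proof -
  let ?\<phi> = "class_fraction M' \<alpha>" and ?\<pi> = "icsp C M' \<alpha>"
  let ?W = "\<Sum>(k, d, s)\<in>Ts. r k * real s * (\<mu> (k, d, s) * h - \<eta>)"
  let ?f = "\<lambda>c. r (fst c) * service_time_within T (a c) (q c)"
  define K' where "K' = {j \<in> K. typical_cell Ts a q w ?\<phi> \<mu> h \<eta> J j}"
  define S where "S j = {c \<in> willing ?\<phi>. a c \<in> {real j * h<..real (Suc j) * h}}" for j
  have S_sub: "S j \<subseteq> {c \<in> customers M. a c \<le> real (Suc j) * h}" for j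
    by (auto simp: S_def willing_def)
  have S_fin: "finite (S j)" for j
    using S_sub finite_before by (rule finite_subset)
  have disj: "S i \<inter> S j = {}" if "i \<noteq> j" for i j
  proof -
    have "S i \<inter> S j = {}" if "i < j" for i j
    proof -
      have "real (Suc i) * h \<le> real j * h"
        using \<open>i < j\<close> \<open>0 < h\<close> by (intro mult_right_mono) auto
      then show ?thesis
        by (auto simp: S_def)
    qed
    with that show ?thesis
      by (metis Int_commute linorder_neqE_nat)
  qed
  have cell: "?W \<le> (\<Sum>c\<in>S j. ?f c)" if "j \<in> K'" for j
  proof -
    have typical: "typical_cell Ts a q w ?\<phi> \<mu> h \<eta> J j" and T: "real (Suc j + J) * h \<le> T"
      using that K(2) by (auto simp: K'_def)
    have "?W \<le> (\<Sum>\<tau>\<in>Ts. (\<lambda>(k, d, s). r k * real s) \<tau> * real (card {n. (fst \<tau>, n) \<in> S j \<and> q (fst \<tau>, n) = snd \<tau>}))"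
    proof (rule sum_mono)
      fix \<tau> assume "\<tau> \<in> Ts"
      then obtain k d s where \<tau>: "\<tau> = (k, d, s)" and k: "k \<in> {1..M}"
        by (auto simp: request_types_def)
      have "\<mu> (k, d, s) * h - \<eta> \<le> real (type_count a q w ?\<phi> (k, d, s) (real j * h) (real (Suc j) * h))"
        using typical \<open>\<tau> \<in> Ts\<close> unfolding typical_cell_def \<tau> by fastforce
      also have "type_count a q w ?\<phi> (k, d, s) (real j * h) (real (Suc j) * h)
          = card {n. (k, n) \<in> S j \<and> q (k, n) = (d, s)}"
        unfolding type_count_def using k
        by (intro arg_cong[where f = card]) (auto simp: S_def willing_def customers_def)
      finally show "(case \<tau> of (k, d, s) \<Rightarrow> r k * real s * (\<mu> (k, d, s) * h - \<eta>))
          \<le> (\<lambda>(k, d, s). r k * real s) \<tau> * real (card {n. (fst \<tau>, n) \<in> S j \<and> q (fst \<tau>, n) = snd \<tau>})"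
        using r[OF k] by (simp add: \<tau> mult_left_mono)
    qed
    also have "\<dots> = (\<Sum>c\<in>S j. (\<lambda>(k, d, s). r k * real s) (fst c, q c))"
      using S_fin S_sub by (intro sum_by_type[symmetric]) auto
    also have "\<dots> = (\<Sum>c\<in>S j. ?f c)"
    proof (rule sum.cong[OF refl])
      fix c assume "c \<in> S j"
      then have c: "c \<in> customers M" "a c \<le> real (Suc j) * h"
        using S_sub by auto
      obtain d s where q: "q c = (d, s)"
        by force
      have "(fst c, d, s) \<in> Ts"
        using c(1) request_bounds[of c] by (auto simp: request_types_def customers_def q)
      then have "a c + real d + real s \<le> T"
        using J[of "fst c" d s] c(2) T by (simp add: algebra_simps)
      then show "(\<lambda>(k, d, s). r k * real s) (fst c, q c) = ?f c"
        using arrival_pos[OF c(1)] by (simp add: q service_time_within_eq)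
    qed
    finally show ?thesis .
  qed
  have "(\<Sum>j\<in>K. if typical_cell Ts a q w ?\<phi> \<mu> h \<eta> J j then ?W else 0) = (\<Sum>j\<in>K'. ?W)"
    by (simp only: K'_def sum.inter_filter[OF K(1)])
  also have "\<dots> \<le> (\<Sum>j\<in>K'. \<Sum>c\<in>S j. ?f c)"
    using cell by (rule sum_mono)
  also have "\<dots> = (\<Sum>c\<in>(\<Union>j\<in>K'. S j). ?f c)"
    using K(1) S_fin disj by (intro sum.UNION_disjoint[symmetric]) (auto simp: K'_def)
  also have "\<dots> \<le> (\<Sum>c\<in>{c \<in> accepted M ?\<pi> a q w. a c \<le> T}. ?f c)"
  proof (rule sum_mono2)
    show "finite {c \<in> accepted M ?\<pi> a q w. a c \<le> T}"
      using accepted_subset by (intro finite_subset[OF _ finite_before[of T]]) auto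
    show "(\<Union>j\<in>K'. S j) \<subseteq> {c \<in> accepted M ?\<pi> a q w. a c \<le> T}"
    proof
      fix c assume "c \<in> (\<Union>j\<in>K'. S j)"
      then obtain j where j: "j \<in> K'" "c \<in> S j"
        by auto
      have "real (Suc j) * h \<le> real (Suc j + J) * h"
        using \<open>0 < h\<close> by (intro mult_right_mono) auto
      then have "a c \<le> T"
        using j K(2)[of j] S_sub[of j] by (auto simp: K'_def)
      moreover have "c \<in> accepted M ?\<pi> a q w"
        by (rule accepted_in_typical_cell[OF assms(1,2) _ load]) (use j J in \<open>auto simp: K'_def S_def\<close>)
      ultimately show "c \<in> {c \<in> accepted M ?\<pi> a q w. a c \<le> T}"
        by simp
    qed
    show "0 \<le> ?f c" if "c \<in> {c \<in> accepted M ?\<pi> a q w. a c \<le> T} - (\<Union>j\<in>K'. S j)" for c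
    proof -
      have "fst c \<in> {1..M}"
        using that accepted_subset[of ?\<pi>] by (auto simp: customers_def)
      then show ?thesis
        by (intro mult_nonneg_nonneg r service_time_within_nonneg)
    qed
  qed
  finally show ?thesis
    by (simp add: path_revenue_def)
qed

end

section \<open>Long-run revenue\<close>

locale bounded_reservation_system = reservation_system P M lam G A X U
  for P :: "'w measure" and M lam G A X U +
  fixes u v :: "nat \<Rightarrow> nat"
  assumes rate_pos: "k \<in> {1..M} \<Longrightarrow> 0 < lam k"
    and requests_bounded: "k \<in> {1..M} \<Longrightarrow> set_pmf (G k) \<subseteq> {0..u k} \<times> {1..v k}"
begin

abbreviation "Ts \<equiv> request_types M u v"
abbreviation "epoch \<omega> \<equiv> (\<lambda>(k, n). A k n \<omega>)"
abbreviation "request \<omega> \<equiv> (\<lambda>(k, n). X k n \<omega>)"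
abbreviation "coin \<omega> \<equiv> (\<lambda>(k, n). U k n \<omega>)"

definition type_rate :: "(nat \<Rightarrow> real) \<Rightarrow> nat \<times> nat \<times> nat \<Rightarrow> real" where
  "type_rate \<phi> = (\<lambda>(k, q). lam k * (pmf (G k) q * \<phi> k))"

lemma AE_sample_path: "AE \<omega> in P. sample_path M u v (epoch \<omega>) (request \<omega>) (coin \<omega>)"
proof -
  have "AE \<omega> in P. \<forall>k\<in>{1..M}. (\<forall>n. 0 < A k n \<omega>) \<and> (\<forall>t. finite {n. A k n \<omega> \<le> t}) \<and>
      (\<forall>n. X k n \<omega> \<in> set_pmf (G k)) \<and> (\<forall>n. U k n \<omega> < 1)"
  proof (rule AE_finite_allI)
    fix k assume k: "k \<in> {1..M}"
    have pp: "poisson_process P (lam k) (A k)"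
      using arrivals[OF k] .
    then have "AE \<omega> in P. 0 < A k 0 \<omega> \<and> strict_mono (\<lambda>n. A k n \<omega>)"
      by (auto simp: poisson_process_def)
    then have "AE \<omega> in P. \<forall>n. 0 < A k n \<omega>"
    proof eventually_elim
      case (elim \<omega>)
      show ?case
      proof
        fix n
        have "A k 0 \<omega> \<le> A k n \<omega>"
          using elim strict_mono_less_eq[of "\<lambda>n. A k n \<omega>" 0 n] by simp
        with elim show "0 < A k n \<omega>"
          by simp
      qed
    qed
    with poisson_process_finite[OF pp] request_AE[OF k] coin_AE[OF k]
    show "AE \<omega> in P. (\<forall>n. 0 < A k n \<omega>) \<and> (\<forall>t. finite {n. A k n \<omega> \<le> t}) \<and>
        (\<forall>n. X k n \<omega> \<in> set_pmf (G k)) \<and> (\<forall>n. U k n \<omega> < 1)"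
      by eventually_elim blast
  qed simp
  then show ?thesis
  proof eventually_elim
    case (elim \<omega>)
    show ?case
    proof
      fix c assume c: "c \<in> customers M"
      show "0 < epoch \<omega> c" "coin \<omega> c < 1"
        using elim c by (auto simp: customers_def)
      show "request \<omega> c \<in> {0..u (fst c)} \<times> {1..v (fst c)}"
        using elim c requests_bounded[of "fst c"] by (cases c) (auto simp: customers_def)
    next
      fix t
      have "{c \<in> customers M. epoch \<omega> c \<le> t} = (SIGMA k:{1..M}. {n. A k n \<omega> \<le> t})"
        by (auto simp: customers_def)
      then show "finite {c \<in> customers M. epoch \<omega> c \<le> t}"
        using elim by auto
    qed
  qed
qed

text \<open>Connects the counts on sample paths with the thinned Poisson processes.\<close>

lemma type_count_eq_points_in:
  assumes "\<omega> \<in> space P"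
  shows "type_count (epoch \<omega>) (request \<omega>) (coin \<omega>) \<phi> (k, q) x y = points_in (A k) (marked k q (\<phi> k)) x y \<omega>"
  using assms by (simp add: type_count_def points_in_def)

lemma type_count_measurable [measurable]:
  assumes "(k, q) \<in> Ts" "0 \<le> \<phi> k" "\<phi> k \<le> 1"
  shows "(\<lambda>\<omega>. type_count (epoch \<omega>) (request \<omega>) (coin \<omega>) \<phi> (k, q) x y) \<in> measurable P (count_space UNIV)"
proof -
  have k: "k \<in> {1..M}"
    using assms(1) by (simp add: request_types_def)
  have "points_in (A k) (marked k q (\<phi> k)) x y \<in> measurable P (count_space UNIV)"
    using arrivals[OF k] marked_thinning[OF k assms(2,3), of q]
    by (intro points_in_measurable) (auto simp: poisson_process_def independent_thinning_def)
  then show ?thesis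
    by (subst measurable_cong[OF type_count_eq_points_in])
qed

lemma type_count_deviation:
  assumes "(k, q) \<in> Ts" "0 \<le> \<phi> k" "\<phi> k \<le> 1" "0 \<le> x" "x < y" "0 < \<eta>"
  shows "prob {\<omega> \<in> space P. \<eta> \<le> \<bar>real (type_count (epoch \<omega>) (request \<omega>) (coin \<omega>) \<phi> (k, q) x y)
      - type_rate \<phi> (k, q) * (y - x)\<bar>} \<le> type_rate \<phi> (k, q) * (y - x) / \<eta>\<^sup>2"
proof -
  have k: "k \<in> {1..M}"
    using assms(1) by (simp add: request_types_def)
  have "lam k * (y - x) * (pmf (G k) q * \<phi> k) = type_rate \<phi> (k, q) * (y - x)"
    by (simp add: type_rate_def)
  with thinned_points_deviation[OF arrivals[OF k] rate_pos[OF k] assms(4,5) marked_thinning[OF k assms(2,3)] assms(6), of q]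
  show ?thesis
    by (simp add: type_count_eq_points_in cong: conj_cong)
qed

lemma type_count_mean:
  assumes "(k, q) \<in> Ts" "0 < T"
  shows "(\<integral>\<^sup>+\<omega>. ennreal (real (type_count (epoch \<omega>) (request \<omega>) (coin \<omega>) (\<lambda>_. 1) (k, q) 0 T)) \<partial>P)
    = ennreal (type_rate (\<lambda>_. 1) (k, q) * T)"
proof -
  have k: "k \<in> {1..M}"
    using assms(1) by (simp add: request_types_def)
  have "(\<integral>\<^sup>+\<omega>. ennreal (real (type_count (epoch \<omega>) (request \<omega>) (coin \<omega>) (\<lambda>_. 1) (k, q) 0 T)) \<partial>P)
     = (\<integral>\<^sup>+\<omega>. of_nat (points_in (A k) (marked k q 1) 0 T \<omega>) \<partial>P)"
    by (intro nn_integral_cong) (simp add: type_count_eq_points_in ennreal_of_nat_eq_real_of_nat)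
  also have "\<dots> = ennreal (lam k * (T - 0) * (pmf (G k) q * 1))"
    using assms(2) by (intro thinned_points_mean arrivals k rate_pos marked_thinning) auto
  finally show ?thesis
    by (simp add: type_rate_def mult_ac)
qed

definition typical_event :: "(nat \<Rightarrow> real) \<Rightarrow> real \<Rightarrow> real \<Rightarrow> nat \<Rightarrow> nat \<Rightarrow> 'w set" where
  "typical_event \<phi> h \<eta> J j =
     {\<omega> \<in> space P. typical_cell Ts (epoch \<omega>) (request \<omega>) (coin \<omega>) \<phi> (type_rate \<phi>) h \<eta> J j}"

text \<open>A union bound over the types and, for each type, the cell itself and its \<open>J + 1\<close> windows; \<open>b\<close> bounds
  all the means and hence the variances. The condition \<open>J \<le> j\<close> makes all windows start at
  nonnegative times, where the arrival processes are defined.\<close>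

lemma typical_event_prob:
  assumes "0 < h" "0 < \<eta>" and \<phi>: "\<And>k. k \<in> {1..M} \<Longrightarrow> 0 \<le> \<phi> k \<and> \<phi> k \<le> 1"
    and J: "\<And>k d s. (k, d, s) \<in> Ts \<Longrightarrow> real d + real s \<le> real J * h"
    and b: "\<And>k d s. (k, d, s) \<in> Ts \<Longrightarrow> type_rate \<phi> (k, d, s) * (real s + h) \<le> b"
    and "J \<le> j"
  shows "typical_event \<phi> h \<eta> J j \<in> events"
    and "1 - real (card Ts * (J + 2)) * (b / \<eta>\<^sup>2) \<le> prob (typical_event \<phi> h \<eta> J j)"
proof -
  define N where "N \<omega> = type_count (epoch \<omega>) (request \<omega>) (coin \<omega>) \<phi>" for \<omega>
  define D where "D \<tau> x y = {\<omega> \<in> space P. \<eta> \<le> \<bar>real (N \<omega> \<tau> x y) - type_rate \<phi> \<tau> * (y - x)\<bar>}" for \<tau> x y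
  define D' where "D' m = (\<lambda>(k, d, s). D (k, d, s) (real m * h - real d - real s) (real (Suc m) * h - real d))" for m
  define D'' where "D'' \<tau> = D \<tau> (real j * h) (real (Suc j) * h)" for \<tau>
  have k: "k \<in> {1..M}" if "(k, q) \<in> Ts" for k q
    using that by (simp add: request_types_def)
  have D_ev: "D (k, q) x y \<in> events" if "(k, q) \<in> Ts" for k q x y
  proof -
    note [measurable] = type_count_measurable[OF that, of \<phi> x y]
    show ?thesis
      unfolding D_def N_def using \<phi>[OF k[OF that]] by simp
  qed
  have D'_ev: "D' m \<tau> \<in> events" and D''_ev: "D'' \<tau> \<in> events" if "\<tau> \<in> Ts" for \<tau> m
    using that D_ev by (cases \<tau>; simp add: D'_def D''_def)+
  have D_prob: "prob (D (k, q) x y) \<le> type_rate \<phi> (k, q) * (y - x) / \<eta>\<^sup>2"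
    if "(k, q) \<in> Ts" "0 \<le> x" "x < y" for k q x y
    unfolding D_def N_def using \<phi>[OF k[OF that(1)]] that \<open>0 < \<eta>\<close> by (intro type_count_deviation) auto
  have D'_prob: "prob (D' m \<tau>) \<le> b / \<eta>\<^sup>2" if "\<tau> \<in> Ts" "j \<le> m" for m \<tau>
  proof -
    obtain k d s where \<tau>: "\<tau> = (k, d, s)"
      by (cases \<tau>)
    have "real J * h \<le> real m * h"
      using \<open>J \<le> j\<close> \<open>j \<le> m\<close> \<open>0 < h\<close> by (intro mult_right_mono) auto
    with J[of k d s] that(1) have "real d + real s \<le> real m * h"
      unfolding \<tau> by linarith
    then have "prob (D' m \<tau>) \<le> type_rate \<phi> (k, d, s) * (real (Suc m) * h - real d - (real m * h - real d - real s)) / \<eta>\<^sup>2"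
      unfolding D'_def \<tau> prod.case using that(1) \<open>0 < h\<close>
      by (intro D_prob) (auto simp: \<tau> algebra_simps)
    also have "real (Suc m) * h - real d - (real m * h - real d - real s) = real s + h"
      by (simp add: algebra_simps)
    also have "type_rate \<phi> (k, d, s) * (real s + h) / \<eta>\<^sup>2 \<le> b / \<eta>\<^sup>2"
      using b that(1) \<tau> by (intro divide_right_mono) auto
    finally show ?thesis .
  qed
  have D''_prob: "prob (D'' \<tau>) \<le> b / \<eta>\<^sup>2" if "\<tau> \<in> Ts" for \<tau>
  proof -
    obtain k d s where \<tau>: "\<tau> = (k, d, s)"
      by (cases \<tau>)
    have nonneg: "0 \<le> type_rate \<phi> (k, d, s)"
      using k[of k "(d, s)"] \<phi>[of k] rate_pos[of k] that by (simp add: type_rate_def \<tau>)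
    have "prob (D'' \<tau>) \<le> type_rate \<phi> (k, d, s) * (real (Suc j) * h - real j * h) / \<eta>\<^sup>2"
      unfolding D''_def \<tau> using that \<open>0 < h\<close> by (intro D_prob) (auto simp: \<tau> algebra_simps)
    also have "real (Suc j) * h - real j * h = h"
      by (simp add: algebra_simps)
    also have "type_rate \<phi> (k, d, s) * h / \<eta>\<^sup>2 \<le> type_rate \<phi> (k, d, s) * (real s + h) / \<eta>\<^sup>2"
      using nonneg by (intro divide_right_mono mult_left_mono) auto
    also have "\<dots> \<le> b / \<eta>\<^sup>2"
      using b that \<tau> by (intro divide_right_mono) auto
    finally show ?thesis .
  qed
  define Bad where "Bad = (\<Union>\<tau>\<in>Ts. D'' \<tau> \<union> (\<Union>m\<in>{j..j + J}. D' m \<tau>))"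
  have Bad_ev: "Bad \<in> events"
    unfolding Bad_def using D'_ev D''_ev by (intro sets.finite_UN sets.Un) auto
  have eq: "typical_event \<phi> h \<eta> J j = space P - Bad"
  proof (intro set_eqI iffI)
    fix \<omega> assume "\<omega> \<in> typical_event \<phi> h \<eta> J j"
    then show "\<omega> \<in> space P - Bad"
      by (fastforce simp: typical_event_def typical_cell_def Bad_def D'_def D''_def D_def N_def not_le algebra_simps)
  next
    fix \<omega> assume \<omega>: "\<omega> \<in> space P - Bad"
    have "\<bar>real (type_count (epoch \<omega>) (request \<omega>) (coin \<omega>) \<phi> (k, d, s) (real j * h) (real (Suc j) * h))
          - type_rate \<phi> (k, d, s) * h\<bar> < \<eta>"
      and "m \<in> {j..j + J} \<Longrightarrow> \<bar>real (type_count (epoch \<omega>) (request \<omega>) (coin \<omega>) \<phi> (k, d, s)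
          (real m * h - real d - real s) (real (Suc m) * h - real d)) - type_rate \<phi> (k, d, s) * (real s + h)\<bar> < \<eta>"
      if "(k, d, s) \<in> Ts" for k d s m
    proof -
      have not_bad: "\<omega> \<in> space P" "\<omega> \<notin> D'' (k, d, s)" "m \<in> {j..j + J} \<Longrightarrow> \<omega> \<notin> D' m (k, d, s)"
        using \<omega> that unfolding Bad_def by blast+
      have "real (Suc j) * h - real j * h = h"
        by (simp add: algebra_simps)
      with not_bad(1,2)
      show "\<bar>real (type_count (epoch \<omega>) (request \<omega>) (coin \<omega>) \<phi> (k, d, s) (real j * h) (real (Suc j) * h))
          - type_rate \<phi> (k, d, s) * h\<bar> < \<eta>"
        by (simp add: D''_def D_def N_def not_le del: of_nat_Suc)
      assume "m \<in> {j..j + J}"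
      have length: "real (Suc m) * h - real d - (real m * h - real d - real s) = real s + h"
        by (simp add: algebra_simps)
      from not_bad(1) not_bad(3)[OF \<open>m \<in> {j..j + J}\<close>]
      show "\<bar>real (type_count (epoch \<omega>) (request \<omega>) (coin \<omega>) \<phi> (k, d, s)
          (real m * h - real d - real s) (real (Suc m) * h - real d)) - type_rate \<phi> (k, d, s) * (real s + h)\<bar> < \<eta>"
        unfolding D'_def prod.case D_def N_def length by (simp add: not_le del: of_nat_Suc)
    qed
    then show "\<omega> \<in> typical_event \<phi> h \<eta> J j"
      using \<omega> by (auto simp: typical_event_def typical_cell_def simp del: of_nat_Suc)
  qed
  show "typical_event \<phi> h \<eta> J j \<in> events"
    unfolding eq using Bad_ev by auto
  have "prob Bad \<le> (\<Sum>\<tau>\<in>Ts. prob (D'' \<tau> \<union> (\<Union>m\<in>{j..j + J}. D' m \<tau>)))"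
    unfolding Bad_def using D'_ev D''_ev by (intro finite_measure_subadditive_finite) auto
  also have "\<dots> \<le> (\<Sum>\<tau>\<in>Ts. real (J + 2) * (b / \<eta>\<^sup>2))"
  proof (rule sum_mono)
    fix \<tau> assume \<tau>: "\<tau> \<in> Ts"
    have "prob (D'' \<tau> \<union> (\<Union>m\<in>{j..j + J}. D' m \<tau>)) \<le> prob (D'' \<tau>) + prob (\<Union>m\<in>{j..j + J}. D' m \<tau>)"
      using D'_ev[OF \<tau>] D''_ev[OF \<tau>] by (intro measure_Un_le) auto
    also have "prob (\<Union>m\<in>{j..j + J}. D' m \<tau>) \<le> (\<Sum>m\<in>{j..j + J}. prob (D' m \<tau>))"
      using D'_ev[OF \<tau>] by (intro finite_measure_subadditive_finite) auto
    also have "\<dots> \<le> (\<Sum>m\<in>{j..j + J}. b / \<eta>\<^sup>2)"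
      using D'_prob[OF \<tau>] by (intro sum_mono) auto
    finally show "prob (D'' \<tau> \<union> (\<Union>m\<in>{j..j + J}. D' m \<tau>)) \<le> real (J + 2) * (b / \<eta>\<^sup>2)"
      using D''_prob[OF \<tau>] unfolding sum_constant card_atLeastAtMost by (simp add: ring_distribs del: times_divide_eq_right)
  qed
  finally have "prob Bad \<le> real (card Ts * (J + 2)) * (b / \<eta>\<^sup>2)"
    by (simp only: sum_constant of_nat_mult mult.assoc)
  then show "1 - real (card Ts * (J + 2)) * (b / \<eta>\<^sup>2) \<le> prob (typical_event \<phi> h \<eta> J j)"
    unfolding eq using prob_compl[OF Bad_ev] by simp
qed

text \<open>The nonnegative integral of a function that may fail to be measurable is a lower integral, so it
  dominates the integral of every smaller random variable. Here this is the revenue from the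
  typical cells alone, a combination of indicators of measurable events.\<close>

lemma nn_integral_revenue_icsp_ge:
  fixes M' C :: nat and \<alpha> :: real
  defines "\<phi> \<equiv> class_fraction M' \<alpha>"
  assumes "0 < h" "0 \<le> \<alpha>"
    and load: "(\<Sum>(k, d, s)\<in>Ts. type_rate \<phi> (k, d, s) * (real s + h) + \<eta>) \<le> real C"
    and J: "\<And>k d s. (k, d, s) \<in> Ts \<Longrightarrow> real d + real s \<le> real J * h"
    and r: "\<And>k. k \<in> {1..M} \<Longrightarrow> 0 \<le> r k"
    and prob: "0 \<le> p" "\<And>j. J \<le> j \<Longrightarrow> typical_event \<phi> h \<eta> J j \<in> events"
      "\<And>j. J \<le> j \<Longrightarrow> p \<le> prob (typical_event \<phi> h \<eta> J j)"
    and W: "W = (\<Sum>(k, d, s)\<in>Ts. r k * real s * (type_rate \<phi> (k, d, s) * h - \<eta>))" "0 \<le> W"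
    and "0 < T"
  shows "ennreal ((T / h - (2 * real J + 1)) * (W * p))
    \<le> (\<integral>\<^sup>+\<omega>. ennreal (revenue M r A X U (icsp C M' \<alpha>) T \<omega>) \<partial>P)"
proof -
  \<comment> \<open>\<open>J\<close> cells are left out at either end: at the beginning so that windows start at nonnegative
    times, at the end so that services finish before \<open>T\<close>. Rounding costs one more cell.\<close>
  define K where "K = {J..<nat \<lfloor>T / h\<rfloor> - J}"
  have K_fit: "real (Suc j + J) * h \<le> T" if "j \<in> K" for j
  proof -
    have "Suc j + J \<le> nat \<lfloor>T / h\<rfloor>"
      using that by (auto simp: K_def)
    then have "real (Suc j + J) \<le> T / h"
      using \<open>0 < T\<close> \<open>0 < h\<close> by linarith
    then show ?thesis
      using \<open>0 < h\<close> by (simp add: pos_le_divide_eq)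
  qed
  have "T / h - (2 * real J + 1) \<le> real (card K)"
    unfolding K_def card_atLeastLessThan by linarith
  then have "ennreal ((T / h - (2 * real J + 1)) * (W * p)) \<le> ennreal (real (card K) * (W * p))"
    using W prob by (intro ennreal_leI mult_right_mono) auto
  also have "\<dots> = (\<Sum>j\<in>K. ennreal W * ennreal p)"
    using W prob by (simp add: ennreal_mult ennreal_of_nat_eq_real_of_nat)
  also have "\<dots> \<le> (\<Sum>j\<in>K. ennreal W * emeasure P (typical_event \<phi> h \<eta> J j))"
    using prob by (intro sum_mono mult_left_mono) (auto simp: K_def emeasure_eq_measure intro!: ennreal_leI)
  also have "\<dots> = (\<integral>\<^sup>+\<omega>. (\<Sum>j\<in>K. ennreal W * indicator (typical_event \<phi> h \<eta> J j) \<omega>) \<partial>P)"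
    using prob(2) by (subst nn_integral_sum) (auto simp: K_def nn_integral_cmult_indicator)
  also have "\<dots> \<le> (\<integral>\<^sup>+\<omega>. ennreal (revenue M r A X U (icsp C M' \<alpha>) T \<omega>) \<partial>P)"
  proof (rule nn_integral_mono_AE)
    show "AE \<omega> in P. (\<Sum>j\<in>K. ennreal W * indicator (typical_event \<phi> h \<eta> J j) \<omega>)
        \<le> ennreal (revenue M r A X U (icsp C M' \<alpha>) T \<omega>)"
      using AE_sample_path AE_space
    proof eventually_elim
      case (elim \<omega>)
      let ?typ = "\<lambda>j. typical_cell Ts (epoch \<omega>) (request \<omega>) (coin \<omega>) \<phi> (type_rate \<phi>) h \<eta> J j"
      have "(\<Sum>j\<in>K. ennreal W * indicator (typical_event \<phi> h \<eta> J j) \<omega>) = (\<Sum>j\<in>K. ennreal (if ?typ j then W else 0))"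
        using elim by (intro sum.cong) (auto simp: typical_event_def)
      also have "\<dots> = ennreal (\<Sum>j\<in>K. if ?typ j then W else 0)"
        using W by (intro sum_ennreal) auto
      also have "\<dots> \<le> ennreal (revenue M r A X U (icsp C M' \<alpha>) T \<omega>)"
        unfolding revenue_def W(1) \<phi>_def using load[unfolded \<phi>_def] J r K_fit
        by (intro ennreal_leI sample_path.path_revenue_icsp_ge[OF elim(1) \<open>0 < h\<close> \<open>0 \<le> \<alpha>\<close>]) (auto simp: K_def)
      finally show ?case .
    qed
  qed
  finally show ?thesis .
qed

text \<open>The cells omitted at both ends of \<open>[0, T]\<close> disappear in the average over \<open>T\<close>.\<close>

lemma long_run_revenue_icsp_ge:
  fixes M' C :: nat and \<alpha> :: real
  defines "\<phi> \<equiv> class_fraction M' \<alpha>"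
  assumes "0 < h" "0 \<le> \<alpha>"
    and load: "(\<Sum>(k, d, s)\<in>Ts. type_rate \<phi> (k, d, s) * (real s + h) + \<eta>) \<le> real C"
    and J: "\<And>k d s. (k, d, s) \<in> Ts \<Longrightarrow> real d + real s \<le> real J * h"
    and r: "\<And>k. k \<in> {1..M} \<Longrightarrow> 0 \<le> r k"
    and prob: "0 \<le> p" "\<And>j. J \<le> j \<Longrightarrow> typical_event \<phi> h \<eta> J j \<in> events"
      "\<And>j. J \<le> j \<Longrightarrow> p \<le> prob (typical_event \<phi> h \<eta> J j)"
    and W: "W = (\<Sum>(k, d, s)\<in>Ts. r k * real s * (type_rate \<phi> (k, d, s) * h - \<eta>))" "0 \<le> W"
  shows "ennreal (W * p / h) \<le> long_run_revenue P M r A X U (icsp C M' \<alpha>)"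
proof -
  let ?g = "\<lambda>T. (1 / h - (2 * real J + 1) / T) * (W * p)"
  have "((\<lambda>T. ?g T) \<longlongrightarrow> (1 / h - 0) * (W * p)) at_top"
    by (intro tendsto_intros tendsto_divide_0[OF tendsto_const] filterlim_at_top_imp_at_infinity filterlim_ident)
  then have "((\<lambda>T. ennreal (?g T)) \<longlongrightarrow> ennreal (W * p / h)) at_top"
    by (intro tendsto_ennrealI) simp
  then have "ennreal (W * p / h) = Liminf at_top (\<lambda>T. ennreal (?g T))"
    by (intro lim_imp_Liminf[symmetric]) auto
  also have "\<dots> \<le> long_run_revenue P M r A X U (icsp C M' \<alpha>)"
    unfolding long_run_revenue_def
  proof (intro Liminf_mono eventually_mono[OF eventually_gt_at_top[of "0::real"]])
    fix T :: real assume "0 < T"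
    have "?g T = (T / h - (2 * real J + 1)) * (W * p) / T"
      using \<open>0 < T\<close> \<open>0 < h\<close> by (simp add: field_simps)
    then have "ennreal (?g T) = ennreal ((T / h - (2 * real J + 1)) * (W * p)) / ennreal T"
      using \<open>0 < T\<close> by (simp only: divide_ennreal_def inverse_ennreal ennreal_mult'' divide_inverse) (simp add: ennreal_mult'')
    also have "\<dots> \<le> (\<integral>\<^sup>+\<omega>. ennreal (revenue M r A X U (icsp C M' \<alpha>) T \<omega>) \<partial>P) / ennreal T"
      using nn_integral_revenue_icsp_ge[of h \<alpha> M' \<eta> C J r p W T] assms \<open>0 < T\<close>
      by (intro divide_right_mono_ennreal) auto
    finally show "ennreal (?g T) \<le> (\<integral>\<^sup>+\<omega>. ennreal (revenue M r A X U (icsp C M' \<alpha>) T \<omega>) \<partial>P) / ennreal T" .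
  qed
  finally show ?thesis .
qed

text \<open>The mean number of arrivals of each type up to \<open>T\<close> is \<open>T\<close> times its rate, so even a system
  without capacity limit earns at most the offered value in the long run.\<close>

lemma optimal_revenue_le:
  assumes r: "\<And>k. k \<in> {1..M} \<Longrightarrow> 0 \<le> r k"
  shows "optimal_revenue P C M r A X U
    \<le> ennreal (\<Sum>(k, d, s)\<in>Ts. r k * real s * type_rate (\<lambda>_. 1) (k, d, s))"
  unfolding optimal_revenue_def
proof (rule SUP_least)
  fix \<pi>
  let ?V = "\<Sum>(k, d, s)\<in>Ts. r k * real s * type_rate (\<lambda>_. 1) (k, d, s)"
  have nonneg: "0 \<le> r k" "0 \<le> type_rate (\<lambda>_. 1) (k, q)" if "(k, q) \<in> Ts" for k q
    using that r[of k] rate_pos[of k] by (auto simp: request_types_def type_rate_def)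
  have "(\<integral>\<^sup>+\<omega>. ennreal (revenue M r A X U \<pi> T \<omega>) \<partial>P) / ennreal T \<le> ennreal ?V" if "0 < T" for T
  proof -
    let ?N = "\<lambda>\<omega> \<tau>. type_count (epoch \<omega>) (request \<omega>) (coin \<omega>) (\<lambda>_. 1) \<tau> 0 T"
    have meas: "(\<lambda>\<omega>. ?N \<omega> \<tau>) \<in> measurable P (count_space UNIV)" if "\<tau> \<in> Ts" for \<tau>
      using type_count_measurable[of "fst \<tau>" "snd \<tau>" "\<lambda>_. 1" 0 T] that by simp
    have "(\<integral>\<^sup>+\<omega>. ennreal (revenue M r A X U \<pi> T \<omega>) \<partial>P)
        \<le> (\<integral>\<^sup>+\<omega>. (\<Sum>\<tau>\<in>Ts. ennreal (r (fst \<tau>) * real (snd (snd \<tau>))) * ennreal (real (?N \<omega> \<tau>))) \<partial>P)"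
    proof (rule nn_integral_mono_AE)
      show "AE \<omega> in P. ennreal (revenue M r A X U \<pi> T \<omega>)
          \<le> (\<Sum>\<tau>\<in>Ts. ennreal (r (fst \<tau>) * real (snd (snd \<tau>))) * ennreal (real (?N \<omega> \<tau>)))"
        using AE_sample_path
      proof eventually_elim
        case (elim \<omega>)
        have "ennreal (revenue M r A X U \<pi> T \<omega>)
            \<le> ennreal (\<Sum>\<tau>\<in>Ts. r (fst \<tau>) * real (snd (snd \<tau>)) * real (?N \<omega> \<tau>))"
          unfolding revenue_def
          using sample_path.path_revenue_le[OF elim r, where \<pi> = \<pi> and T = T] by (intro ennreal_leI) (simp add: case_prod_beta)
        also have "\<dots> = (\<Sum>\<tau>\<in>Ts. ennreal (r (fst \<tau>) * real (snd (snd \<tau>)) * real (?N \<omega> \<tau>)))"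
          using nonneg by (intro sum_ennreal[symmetric] mult_nonneg_nonneg) auto
        also have "\<dots> = (\<Sum>\<tau>\<in>Ts. ennreal (r (fst \<tau>) * real (snd (snd \<tau>))) * ennreal (real (?N \<omega> \<tau>)))"
          by (intro sum.cong ennreal_mult'') auto
        finally show ?case .
      qed
    qed
    also have "\<dots> = (\<Sum>\<tau>\<in>Ts. \<integral>\<^sup>+\<omega>. ennreal (r (fst \<tau>) * real (snd (snd \<tau>))) * ennreal (real (?N \<omega> \<tau>)) \<partial>P)"
    proof (rule nn_integral_sum)
      fix \<tau> assume "\<tau> \<in> Ts"
      note [measurable] = meas[OF this]
      show "(\<lambda>\<omega>. ennreal (r (fst \<tau>) * real (snd (snd \<tau>))) * ennreal (real (?N \<omega> \<tau>))) \<in> borel_measurable P"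
        by measurable
    qed
    also have "\<dots> = (\<Sum>\<tau>\<in>Ts. ennreal (r (fst \<tau>) * real (snd (snd \<tau>)) * (type_rate (\<lambda>_. 1) \<tau> * T)))"
    proof (intro sum.cong refl)
      fix \<tau> assume \<tau>: "\<tau> \<in> Ts"
      note [measurable] = meas[OF this]
      have "(\<integral>\<^sup>+\<omega>. ennreal (r (fst \<tau>) * real (snd (snd \<tau>))) * ennreal (real (?N \<omega> \<tau>)) \<partial>P)
          = ennreal (r (fst \<tau>) * real (snd (snd \<tau>))) * (\<integral>\<^sup>+\<omega>. ennreal (real (?N \<omega> \<tau>)) \<partial>P)"
        by (rule nn_integral_cmult) measurable
      also have "\<dots> = ennreal (r (fst \<tau>) * real (snd (snd \<tau>)) * (type_rate (\<lambda>_. 1) \<tau> * T))"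
        using type_count_mean[of "fst \<tau>" "snd \<tau>" T] nonneg[of "fst \<tau>" "snd \<tau>"] \<tau> \<open>0 < T\<close>
        by (simp add: ennreal_mult)
      finally show "(\<integral>\<^sup>+\<omega>. ennreal (r (fst \<tau>) * real (snd (snd \<tau>))) * ennreal (real (?N \<omega> \<tau>)) \<partial>P)
          = ennreal (r (fst \<tau>) * real (snd (snd \<tau>)) * (type_rate (\<lambda>_. 1) \<tau> * T))" .
    qed
    also have "\<dots> = ennreal (\<Sum>\<tau>\<in>Ts. r (fst \<tau>) * real (snd (snd \<tau>)) * (type_rate (\<lambda>_. 1) \<tau> * T))"
      using nonneg \<open>0 < T\<close> by (intro sum_ennreal mult_nonneg_nonneg) auto
    also have "(\<Sum>\<tau>\<in>Ts. r (fst \<tau>) * real (snd (snd \<tau>)) * (type_rate (\<lambda>_. 1) \<tau> * T)) = ?V * T"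
      by (simp add: sum_distrib_right case_prod_beta mult.assoc)
    finally have "(\<integral>\<^sup>+\<omega>. ennreal (revenue M r A X U \<pi> T \<omega>) \<partial>P) / ennreal T \<le> ennreal (?V * T) / ennreal T"
      by (rule divide_right_mono_ennreal)
    also have "\<dots> = ennreal ?V"
      using \<open>0 < T\<close> by (simp add: ennreal_mult'' ennreal_mult_divide_eq)
    finally show ?thesis .
  qed
  then have "long_run_revenue P M r A X U \<pi> \<le> Liminf at_top (\<lambda>T::real. ennreal ?V)"
    unfolding long_run_revenue_def
    by (intro Liminf_mono eventually_mono[OF eventually_gt_at_top[of "0::real"]])
  then show "long_run_revenue P M r A X U \<pi> \<le> ennreal ?V"
    by (simp add: Liminf_const)
qed

end

section \<open>The knapsack linear program and the performance of the policy\<close>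

lemma ennreal_inverse_antimono:
  fixes x y :: ennreal
  shows "x \<le> y \<Longrightarrow> inverse y \<le> inverse x"
  including ennreal.lifting by transfer (rule ereal_inverse_antimono)

lemma sum_request_types:
  fixes f :: "nat \<Rightarrow> nat \<Rightarrow> nat \<Rightarrow> real"
  shows "(\<Sum>k=1..M. \<Sum>d=0..u k. \<Sum>s=1..v k. f k d s) = (\<Sum>(k, d, s)\<in>request_types M u v. f k d s)"
  unfolding request_types_def by (simp add: sum.Sigma sum.cartesian_product)

lemma mean_service_eq:
  assumes "set_pmf g \<subseteq> {0..m} \<times> {1..n}"
  shows "mean_service g = (\<Sum>d=0..m. \<Sum>s=1..n. pmf g (d, s) * real s)"
proof -
  have "mean_service g = (\<Sum>q\<in>{0..m} \<times> {1..n}. pmf g q *\<^sub>R (case q of (d, s) \<Rightarrow> real s))"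
    unfolding mean_service_def using assms by (intro integral_measure_pmf) auto
  also have "\<dots> = (\<Sum>d=0..m. \<Sum>s=1..n. pmf g (d, s) * real s)"
    unfolding sum.cartesian_product by (intro sum.cong) auto
  finally show ?thesis .
qed

context bounded_reservation_system
begin

lemma traffic_intensity_eq:
  "traffic_intensity M lam G = (\<Sum>(k, d, s)\<in>Ts. type_rate (\<lambda>_. 1) (k, d, s) * real s)"
proof -
  have "traffic_intensity M lam G = (\<Sum>k=1..M. \<Sum>d=0..u k. \<Sum>s=1..v k. lam k * pmf (G k) (d, s) * real s)"
    unfolding traffic_intensity_def
    by (intro sum.cong refl) (simp add: mean_service_eq[OF requests_bounded] sum_distrib_left mult.assoc)
  then show ?thesis
    unfolding sum_request_types by (simp add: type_rate_def)
qed

lemma lp_load_eq: "lp_load M u v lam G (\<lambda>d s k. \<phi> k) = (\<Sum>(k, d, s)\<in>Ts. type_rate \<phi> (k, d, s) * real s)"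
  unfolding lp_load_def sum_request_types by (intro sum.cong) (auto simp: type_rate_def)

lemma lp_value_eq: "lp_value M u v r lam G (\<lambda>d s k. \<phi> k) = (\<Sum>(k, d, s)\<in>Ts. r k * real s * type_rate \<phi> (k, d, s))"
  unfolding lp_value_def sum_request_types by (intro sum.cong) (auto simp: type_rate_def)

definition offered_value :: "(nat \<Rightarrow> real) \<Rightarrow> real" where
  "offered_value r = (\<Sum>(k, d, s)\<in>Ts. r k * real s * type_rate (\<lambda>_. 1) (k, d, s))"

lemma type_rate_uniform: "type_rate (\<lambda>_. \<beta>) \<tau> = \<beta> * type_rate (\<lambda>_. 1) \<tau>"
  by (simp add: type_rate_def split: prod.split)

lemma type_rate_nonneg:
  assumes "(k, q) \<in> Ts" "0 \<le> \<phi> k"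
  shows "0 \<le> type_rate \<phi> (k, q)"
  using assms rate_pos[of k] by (simp add: request_types_def type_rate_def)

text \<open>Accepting every request with probability \<open>\<beta>\<close> uses a fraction \<open>\<beta>\<close> of the offered load and earns a
  fraction \<open>\<beta>\<close> of the offered value, and an optimal solution is at least as good.\<close>

lemma lp_value_greedy_ge:
  assumes "greedy_solution M u v r lam G (\<beta> * traffic_intensity M lam G) M' \<alpha>" "0 \<le> \<beta>" "\<beta> \<le> 1"
  shows "\<beta> * offered_value r \<le> (\<Sum>(k, d, s)\<in>Ts. r k * real s * type_rate (class_fraction M' \<alpha>) (k, d, s))"
proof -
  have "lp_load M u v lam G (\<lambda>d s k. \<beta>) = \<beta> * traffic_intensity M lam G"
    unfolding lp_load_eq traffic_intensity_eq sum_distrib_left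
    by (intro sum.cong) (auto simp: type_rate_uniform[of \<beta>])
  then have "lp_feasible M u v lam G (\<beta> * traffic_intensity M lam G) (\<lambda>d s k. \<beta>)"
    using assms(2,3) by (simp add: lp_feasible_def)
  then have "lp_value M u v r lam G (\<lambda>d s k. \<beta>) \<le> lp_value M u v r lam G (\<lambda>d s k. class_fraction M' \<alpha> k)"
    using assms(1) by (simp add: greedy_solution_def lp_optimal_def)
  moreover have "lp_value M u v r lam G (\<lambda>d s k. \<beta>) = \<beta> * offered_value r"
    unfolding lp_value_eq offered_value_def sum_distrib_left
    by (intro sum.cong) (auto simp: type_rate_uniform[of \<beta>])
  ultimately show ?thesis
    by (simp add: lp_value_eq)
qed

lemma greedy_load_le:
  assumes "greedy_solution M u v r lam G b M' \<alpha>"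
  shows "(\<Sum>(k, d, s)\<in>Ts. type_rate (class_fraction M' \<alpha>) (k, d, s) * real s) \<le> b"
  using assms by (simp add: greedy_solution_def lp_optimal_def lp_feasible_def lp_load_eq)

text \<open>Converts an error proportional to the capacity into one proportional to the offered value.\<close>

lemma offered_value_ge:
  assumes "\<And>k. k \<in> {1..M} \<Longrightarrow> r_min \<le> r k"
  shows "r_min * traffic_intensity M lam G \<le> offered_value r"
  unfolding offered_value_def traffic_intensity_eq sum_distrib_left
proof (rule sum_mono)
  fix \<tau> assume "\<tau> \<in> Ts"
  moreover obtain k d s where \<tau>: "\<tau> = (k, d, s)"
    by (cases \<tau>)
  ultimately have k: "k \<in> {1..M}" and nn: "0 \<le> type_rate (\<lambda>_. 1) (k, d, s)"
    using type_rate_nonneg[of k "(d, s)" "\<lambda>_. 1"] by (auto simp: request_types_def)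
  have "r_min * (type_rate (\<lambda>_. 1) (k, d, s) * real s) \<le> r k * (type_rate (\<lambda>_. 1) (k, d, s) * real s)"
    using assms[OF k] nn by (intro mult_right_mono) auto
  then show "r_min * (case \<tau> of (k, d, s) \<Rightarrow> type_rate (\<lambda>_. 1) (k, d, s) * real s)
      \<le> (case \<tau> of (k, d, s) \<Rightarrow> r k * real s * type_rate (\<lambda>_. 1) (k, d, s))"
    by (simp add: \<tau> mult_ac)
qed

lemma traffic_intensity_pos:
  assumes "1 \<le> M"
  shows "0 < traffic_intensity M lam G"
  unfolding traffic_intensity_def
proof (rule sum_pos)
  fix k assume k: "k \<in> {1..M}"
  let ?Q = "{0..u k} \<times> {1..v k}"
  have "1 = (\<Sum>q\<in>?Q. pmf (G k) q)"
    using requests_bounded[OF k] by (intro sum_pmf_eq_1[symmetric]) auto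
  also have "\<dots> \<le> (\<Sum>q\<in>?Q. pmf (G k) q * real (snd q))"
  proof (rule sum_mono)
    fix q assume "q \<in> ?Q"
    then show "pmf (G k) q \<le> pmf (G k) q * real (snd q)"
      using mult_left_mono[of 1 "real (snd q)" "pmf (G k) q"] by auto
  qed
  also have "\<dots> = mean_service (G k)"
    unfolding mean_service_eq[OF requests_bounded[OF k]] sum.cartesian_product
    by (intro sum.cong) auto
  finally show "0 < lam k * mean_service (G k)"
    using rate_pos[OF k] by simp
qed (use assms in auto)

text \<open>The bound for a single system. Cells have length \<open>\<epsilon>\<close> and the tolerated deviation is \<open>\<theta> C\<close>. The
  factor \<open>\<kappa>\<close> is the fraction \<open>1 - \<epsilon>\<^sup>2\<close> of the offered value that the linear program guarantees, less
  what the deviations may cost; \<open>p\<close> is the lower bound on the probability of a typical cell.\<close>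

lemma icsp_performance:
  assumes "1 \<le> M" and r: "\<And>k. k \<in> {1..M} \<Longrightarrow> 0 < r k" "\<And>k. k \<in> {1..M} \<Longrightarrow> r_min \<le> r k" "0 < r_min"
    and \<epsilon>: "0 < \<epsilon>" "\<epsilon> < 1"
    and C: "real C = (1 + \<epsilon>) * traffic_intensity M lam G"
    and greedy: "greedy_solution M u v r lam G ((1 - \<epsilon>) * real C) M' \<alpha>"
    and J: "\<And>k d s. (k, d, s) \<in> Ts \<Longrightarrow> real d + real s \<le> real J * \<epsilon>"
    and \<theta>: "0 < \<theta>" "real (card Ts) * \<theta> \<le> \<epsilon>\<^sup>2"
    and \<kappa>: "\<kappa> = 1 - \<epsilon>\<^sup>2 - \<theta> * ((1 + \<epsilon>) * (\<Sum>(k, d, s)\<in>Ts. r k * real s) / (\<epsilon> * r_min))" "0 \<le> \<kappa>"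
    and p: "p = 1 - real (card Ts * (J + 2)) / (\<theta>\<^sup>2 * real C)" "0 \<le> p"
  shows "ennreal (\<kappa> * p)
    \<le> long_run_revenue P M r A X U (icsp C M' \<alpha>) / optimal_revenue P C M r A X U"
proof -
  define \<phi> where "\<phi> = class_fraction M' \<alpha>"
  define V where "V = offered_value r"
  define L where "L = (\<Sum>(k, d, s)\<in>Ts. r k * real s * type_rate \<phi> (k, d, s))"
  define R where "R = (\<Sum>(k, d, s)\<in>Ts. r k * real s)"
  define W where "W = (\<Sum>(k, d, s)\<in>Ts. r k * real s * (type_rate \<phi> (k, d, s) * \<epsilon> - \<theta> * real C))"
  let ?\<rho> = "traffic_intensity M lam G"
  have \<alpha>: "0 \<le> \<alpha>" "\<alpha> \<le> 1"
    using greedy by (auto simp: greedy_solution_def)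
  then have \<phi>: "0 \<le> \<phi> k" "\<phi> k \<le> 1" for k
    by (auto simp: \<phi>_def class_fraction_def)
  have \<rho>: "0 < ?\<rho>"
    using \<open>1 \<le> M\<close> by (rule traffic_intensity_pos)
  then have C_pos: "0 < real C"
    using C \<epsilon> by simp
  have cap: "(1 - \<epsilon>) * real C = (1 - \<epsilon>\<^sup>2) * ?\<rho>"
    unfolding C by (simp add: algebra_simps power2_eq_square)
  have \<epsilon>2: "\<epsilon>\<^sup>2 \<le> 1"
    using \<epsilon> by (simp add: power_le_one)
  have L_ge: "(1 - \<epsilon>\<^sup>2) * V \<le> L"
    unfolding L_def V_def \<phi>_def using greedy \<epsilon>2 by (intro lp_value_greedy_ge) (auto simp flip: cap)
  have V_ge: "r_min * ?\<rho> \<le> V"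
    unfolding V_def by (rule offered_value_ge[OF r(2)])
  then have V_pos: "0 < V"
    using \<rho> r(3) by (meson less_le_trans mult_pos_pos)
  have "(\<Sum>(k, d, s)\<in>Ts. type_rate \<phi> (k, d, s) * (real s + \<epsilon>))
      \<le> (\<Sum>(k, d, s)\<in>Ts. (1 + \<epsilon>) * (type_rate \<phi> (k, d, s) * real s))"
  proof (intro sum_mono, clarify)
    fix k d s assume "(k, d, s) \<in> Ts"
    then have "0 \<le> type_rate \<phi> (k, d, s)" "1 \<le> real s"
      using type_rate_nonneg[of k "(d, s)" \<phi>] \<phi> by (auto simp: request_types_def)
    moreover from this have "type_rate \<phi> (k, d, s) * \<epsilon> * 1 \<le> type_rate \<phi> (k, d, s) * \<epsilon> * real s"
      using \<epsilon> by (intro mult_left_mono) auto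
    ultimately show "type_rate \<phi> (k, d, s) * (real s + \<epsilon>) \<le> (1 + \<epsilon>) * (type_rate \<phi> (k, d, s) * real s)"
      by (simp add: algebra_simps)
  qed
  also have "\<dots> = (1 + \<epsilon>) * (\<Sum>(k, d, s)\<in>Ts. type_rate \<phi> (k, d, s) * real s)"
    by (simp add: sum_distrib_left case_prod_beta)
  also have "\<dots> \<le> (1 + \<epsilon>) * ((1 - \<epsilon>) * real C)"
    using greedy_load_le[OF greedy] \<epsilon> by (intro mult_left_mono) (auto simp: \<phi>_def)
  \<comment> \<open>Even after widening the windows by the factor \<open>1 + \<epsilon>\<close>, a slack of \<open>\<epsilon>\<^sup>2 C\<close> is left to pay
    for the deviations.\<close>
  also have "\<dots> = (1 - \<epsilon>\<^sup>2) * real C"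
    by (simp add: algebra_simps power2_eq_square)
  finally have load0: "(\<Sum>(k, d, s)\<in>Ts. type_rate \<phi> (k, d, s) * (real s + \<epsilon>)) \<le> (1 - \<epsilon>\<^sup>2) * real C" .
  have "(\<Sum>(k, d, s)\<in>Ts. type_rate \<phi> (k, d, s) * (real s + \<epsilon>) + \<theta> * real C)
      = (\<Sum>(k, d, s)\<in>Ts. type_rate \<phi> (k, d, s) * (real s + \<epsilon>)) + real (card Ts) * \<theta> * real C"
    by (simp add: sum.distrib case_prod_beta)
  also have "\<dots> \<le> (1 - \<epsilon>\<^sup>2) * real C + \<epsilon>\<^sup>2 * real C"
    using load0 \<theta>(2) C_pos by (intro add_mono mult_right_mono) auto
  finally have load: "(\<Sum>(k, d, s)\<in>Ts. type_rate \<phi> (k, d, s) * (real s + \<epsilon>) + \<theta> * real C) \<le> real C"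
    by (simp add: algebra_simps)
  have mean: "type_rate \<phi> (k, d, s) * (real s + \<epsilon>) \<le> real C" if "(k, d, s) \<in> Ts" for k d s
  proof -
    have "type_rate \<phi> (k, d, s) * (real s + \<epsilon>) \<le> (\<Sum>(k, d, s)\<in>Ts. type_rate \<phi> (k, d, s) * (real s + \<epsilon>))"
      using member_le_sum[of "(k, d, s)" Ts "\<lambda>(k, d, s). type_rate \<phi> (k, d, s) * (real s + \<epsilon>)"] that type_rate_nonneg \<phi> \<epsilon>
      by auto
    also have "\<dots> \<le> (1 - \<epsilon>\<^sup>2) * real C"
      by (rule load0)
    also have "\<dots> \<le> real C"
      using C_pos by (simp add: algebra_simps)
    finally show ?thesis .
  qed
  have "real C / (\<theta> * real C)\<^sup>2 = 1 / (\<theta>\<^sup>2 * real C)"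
    using C_pos by (simp add: power2_eq_square field_simps)
  then have p_eq: "p = 1 - real (card Ts * (J + 2)) * (real C / (\<theta> * real C)\<^sup>2)"
    by (simp add: p(1))
  have typical: "typical_event \<phi> \<epsilon> (\<theta> * real C) J j \<in> events" "p \<le> prob (typical_event \<phi> \<epsilon> (\<theta> * real C) J j)"
    if "J \<le> j" for j
    using typical_event_prob[where \<phi> = \<phi> and h = \<epsilon> and \<eta> = "\<theta> * real C" and b = "real C" and J = J and j = j]
      \<epsilon> \<theta>(1) C_pos \<phi> J mean that unfolding p_eq by auto
  have W_eq: "W = \<epsilon> * L - \<theta> * real C * R"
    by (simp add: W_def L_def R_def sum_distrib_left right_diff_distrib sum_subtractf case_prod_beta mult_ac)
  have R: "0 \<le> R"
    unfolding R_def using r(1) by (intro sum_nonneg) (auto simp: request_types_def less_imp_le)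
  have "real C \<le> (1 + \<epsilon>) * (V / r_min)"
    unfolding C using V_ge r(3) \<epsilon> by (intro mult_left_mono) (auto simp: pos_le_divide_eq mult.commute)
  then have "\<theta> * real C * R \<le> \<theta> * ((1 + \<epsilon>) * (V / r_min)) * R"
    using \<theta>(1) R by (intro mult_right_mono mult_left_mono) auto
  moreover have "\<epsilon> * ((1 - \<epsilon>\<^sup>2) * V) \<le> \<epsilon> * L"
    using L_ge \<epsilon> by (intro mult_left_mono) auto
  ultimately have "\<epsilon> * ((1 - \<epsilon>\<^sup>2) * V) - \<theta> * ((1 + \<epsilon>) * (V / r_min)) * R \<le> W"
    unfolding W_eq by linarith
  moreover have "\<epsilon> * ((1 - \<epsilon>\<^sup>2) * V) - \<theta> * ((1 + \<epsilon>) * (V / r_min)) * R = \<epsilon> * (V * \<kappa>)"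
    unfolding \<kappa>(1) R_def[symmetric] using \<epsilon> r(3) by (simp add: field_simps)
  ultimately have W_ge: "\<epsilon> * (V * \<kappa>) \<le> W"
    by simp
  then have W_nonneg: "0 \<le> W"
    using \<epsilon> V_pos \<kappa>(2) by (meson order_trans mult_nonneg_nonneg less_imp_le)
  have "V * \<kappa> \<le> W / \<epsilon>"
    using W_ge \<epsilon> by (simp add: pos_le_divide_eq mult.commute)
  then have "V * \<kappa> * p \<le> W / \<epsilon> * p"
    using p(2) by (rule mult_right_mono)
  then have "ennreal (\<kappa> * p) * ennreal V \<le> ennreal (W * p / \<epsilon>)"
    using V_pos by (subst ennreal_mult''[symmetric]) (auto intro!: ennreal_leI simp: mult_ac)
  also have "\<dots> \<le> long_run_revenue P M r A X U (icsp C M' \<alpha>)"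
    using load J r(1) p(2) typical W_nonneg \<epsilon>(1) \<alpha>(1)
    by (intro long_run_revenue_icsp_ge[where \<eta> = "\<theta> * real C" and J = J]) (auto simp: W_def \<phi>_def less_imp_le)
  finally have "ennreal (\<kappa> * p) * ennreal V / ennreal V \<le> long_run_revenue P M r A X U (icsp C M' \<alpha>) / ennreal V"
    by (rule divide_right_mono_ennreal)
  also have "ennreal (\<kappa> * p) * ennreal V / ennreal V = ennreal (\<kappa> * p)"
    using V_pos by (simp add: ennreal_mult_divide_eq)
  also have "long_run_revenue P M r A X U (icsp C M' \<alpha>) / ennreal V
      \<le> long_run_revenue P M r A X U (icsp C M' \<alpha>) / optimal_revenue P C M r A X U"
    using optimal_revenue_le[of r C] r(1)
    unfolding divide_ennreal_def V_def offered_value_def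
    by (intro mult_left_mono ennreal_inverse_antimono) (auto simp: less_imp_le)
  finally show ?thesis .
qed

end

theorem theorem2:
  fixes M :: nat
    and r p :: "nat \<Rightarrow> real"
    and u v :: "nat \<Rightarrow> nat"
    and G :: "nat \<Rightarrow> (nat \<times> nat) pmf"
    and \<epsilon> :: real
    and C :: "nat \<Rightarrow> nat"
    and lam :: "nat \<Rightarrow> nat \<Rightarrow> real"
    and P :: "nat \<Rightarrow> 'w measure"
    and A U :: "nat \<Rightarrow> nat \<Rightarrow> nat \<Rightarrow> 'w \<Rightarrow> real"
    and X :: "nat \<Rightarrow> nat \<Rightarrow> nat \<Rightarrow> 'w \<Rightarrow> nat \<times> nat"
    and M' :: "nat \<Rightarrow> nat"
    and \<alpha> :: "nat \<Rightarrow> real"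
  assumes "1 \<le> M"
    and "\<And>k. k \<in> {1..M} \<Longrightarrow> 0 < r k"
    and "\<And>k l. 1 \<le> k \<Longrightarrow> k \<le> l \<Longrightarrow> l \<le> M \<Longrightarrow> r l \<le> r k"
    and "\<And>k. k \<in> {1..M} \<Longrightarrow> set_pmf (G k) \<subseteq> {0..u k} \<times> {1..v k}"
    and "\<And>j k. k \<in> {1..M} \<Longrightarrow> 0 < lam j k"
    and "\<And>j k. k \<in> {1..M} \<Longrightarrow> lam j k / (\<Sum>i=1..M. lam j i) = p k"
    and "\<And>j. reservation_system (P j) M (lam j) G (A j) (X j) (U j)"
    and "\<And>j. real (C j) = (1 + \<epsilon>) * traffic_intensity M (lam j) G"
    and "filterlim C at_top sequentially"
    and "0 < \<epsilon>"
    and "\<And>j. \<epsilon> < Min ((\<lambda>k. lam j k * mean_service (G k) / real (C j)) ` {1..M})"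
    and "\<And>j. greedy_solution M u v r (lam j) G ((1 - \<epsilon>) * real (C j)) (M' j) (\<alpha> j)"
  shows "ennreal (1 - \<epsilon>) \<le>
    liminf (\<lambda>j. long_run_revenue (P j) M r (A j) (X j) (U j) (icsp (C j) (M' j) (\<alpha> j))
                / optimal_revenue (P j) (C j) M r (A j) (X j) (U j))"
proof (cases "\<epsilon> < 1")
  case False
  then show ?thesis
    by (simp add: ennreal_neg)
next
  case True
  let ?Ts = "request_types M u v"
  \<comment> \<open>The number of cells of length \<open>\<epsilon>\<close> that a requested interval can extend beyond the arrival.\<close>
  define J where "J = nat \<lceil>real (Max ((\<lambda>(k, d, s). d + s) ` ?Ts)) / \<epsilon>\<rceil>"
  have J: "real d + real s \<le> real J * \<epsilon>" if "(k, d, s) \<in> ?Ts" for k d s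
  proof -
    have "d + s \<le> Max ((\<lambda>(k, d, s). d + s) ` ?Ts)"
      using that by (intro Max_ge) force+
    moreover have "real (Max ((\<lambda>(k, d, s). d + s) ` ?Ts)) / \<epsilon> \<le> real J"
      unfolding J_def by (rule real_nat_ceiling_ge)
    then have "real (Max ((\<lambda>(k, d, s). d + s) ` ?Ts)) \<le> real J * \<epsilon>"
      using \<open>0 < \<epsilon>\<close> by (simp only: pos_divide_le_eq)
    ultimately show ?thesis
      by linarith
  qed
  define c where "c = (1 + \<epsilon>) * (\<Sum>(k, d, s)\<in>?Ts. r k * real s) / (\<epsilon> * r M)"
  \<comment> \<open>The first bound keeps the deviations within the slack \<open>\<epsilon>\<^sup>2 C\<close>; the second makes their cost at most
    half of the gap \<open>\<epsilon> (1 - \<epsilon>)\<close> between \<open>1 - \<epsilon>\<^sup>2\<close> and \<open>1 - \<epsilon>\<close>.\<close>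
  define \<theta> where "\<theta> = min (\<epsilon>\<^sup>2 / (real (card ?Ts) + 1)) (\<epsilon> * (1 - \<epsilon>) / (2 * (c + 1)))"
  define \<kappa> where "\<kappa> = 1 - \<epsilon>\<^sup>2 - \<theta> * c"
  have rM: "0 < r M"
    using assms(1,2) by simp
  have "0 \<le> (\<Sum>(k, d, s)\<in>?Ts. r k * real s)"
    using assms(2) by (intro sum_nonneg) (auto simp: request_types_def less_imp_le)
  then have c: "0 \<le> c"
    using \<open>0 < \<epsilon>\<close> rM by (simp add: c_def)
  then have \<theta>_pos: "0 < \<theta>"
    using \<open>0 < \<epsilon>\<close> True by (simp add: \<theta>_def add_nonneg_pos)
  have "real (card ?Ts) * \<theta> \<le> (real (card ?Ts) + 1) * \<theta>"
    using \<theta>_pos by (intro mult_right_mono) auto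
  also have "\<dots> \<le> (real (card ?Ts) + 1) * (\<epsilon>\<^sup>2 / (real (card ?Ts) + 1))"
    by (intro mult_left_mono) (auto simp: \<theta>_def)
  finally have \<theta>_card: "real (card ?Ts) * \<theta> \<le> \<epsilon>\<^sup>2"
    by simp
  have "\<theta> * c \<le> \<theta> * (c + 1)"
    using \<theta>_pos by (intro mult_left_mono) auto
  also have "\<dots> \<le> \<epsilon> * (1 - \<epsilon>) / (2 * (c + 1)) * (c + 1)"
    using c by (intro mult_right_mono) (auto simp: \<theta>_def)
  also have "\<dots> = \<epsilon> * (1 - \<epsilon>) / 2"
    using c by (simp add: field_simps)
  finally have "\<theta> * c \<le> \<epsilon> * (1 - \<epsilon>) / 2" .
  moreover have "1 - \<epsilon>\<^sup>2 = (1 - \<epsilon>) + \<epsilon> * (1 - \<epsilon>)" "0 < \<epsilon> * (1 - \<epsilon>)"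
    using \<open>0 < \<epsilon>\<close> True by (simp_all add: algebra_simps power2_eq_square)
  ultimately have \<kappa>: "1 - \<epsilon> < \<kappa>"
    unfolding \<kappa>_def by linarith
  define q where "q j = 1 - real (card ?Ts * (J + 2)) / (\<theta>\<^sup>2 * real (C j))" for j
  have "filterlim (\<lambda>j. \<theta>\<^sup>2 * real (C j)) at_top sequentially"
    using \<theta>_pos assms(9)
    by (intro filterlim_tendsto_pos_mult_at_top[OF tendsto_const] filterlim_compose[OF filterlim_real_sequentially]) auto
  then have "q \<longlonglongrightarrow> 1 - 0"
    unfolding q_def
    by (intro tendsto_intros tendsto_divide_0[OF tendsto_const] filterlim_at_top_imp_at_infinity)
  then have q: "q \<longlonglongrightarrow> 1"
    by simp
  then have "(\<lambda>j. \<kappa> * q j) \<longlonglongrightarrow> \<kappa> * 1"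
    by (intro tendsto_intros)
  then have "eventually (\<lambda>j. 1 - \<epsilon> < \<kappa> * q j) sequentially"
    using \<kappa> by (intro order_tendstoD) auto
  moreover have "eventually (\<lambda>j. 0 < q j) sequentially"
    using q by (intro order_tendstoD) auto
  ultimately have "eventually (\<lambda>j. ennreal (1 - \<epsilon>) \<le>
      long_run_revenue (P j) M r (A j) (X j) (U j) (icsp (C j) (M' j) (\<alpha> j))
        / optimal_revenue (P j) (C j) M r (A j) (X j) (U j)) sequentially"
  proof eventually_elim
    case (elim j)
    interpret reservation_system "P j" M "lam j" G "A j" "X j" "U j"
      by (rule assms(7))
    interpret bounded_reservation_system "P j" M "lam j" G "A j" "X j" "U j" u v
      by unfold_locales (use assms(4,5) in auto)
    have "ennreal (1 - \<epsilon>) \<le> ennreal (\<kappa> * q j)"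
      using elim by (intro ennreal_leI) auto
    also have "\<dots> \<le> long_run_revenue (P j) M r (A j) (X j) (U j) (icsp (C j) (M' j) (\<alpha> j))
        / optimal_revenue (P j) (C j) M r (A j) (X j) (U j)"
    proof (rule icsp_performance[where J = J and \<theta> = \<theta> and r_min = "r M" and \<epsilon> = \<epsilon>])
      show "\<kappa> = 1 - \<epsilon>\<^sup>2 - \<theta> * ((1 + \<epsilon>) * (\<Sum>(k, d, s)\<in>?Ts. r k * real s) / (\<epsilon> * r M))"
        by (simp add: \<kappa>_def c_def)
      show "0 \<le> \<kappa>" "0 \<le> q j"
        using \<kappa> True elim by auto
      show "q j = 1 - real (card ?Ts * (J + 2)) / (\<theta>\<^sup>2 * real (C j))"
        by (simp add: q_def)
    qed (use assms True J \<theta>_pos \<theta>_card rM in auto)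
    finally show ?case .
  qed
  then show ?thesis
    by (rule Liminf_bounded)
qed

end
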